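(* Let $r>0$, $0<t_*<\infty$, $D>1$. For the time-dependent Kolmogorov operator of the elliptic Bessel process with parameter $D$, $$\mathcal L_1^{(D)}(t)=\frac12\frac{\partial^2}{\partial x^2}+\frac{D-1}{2}\frac{\partial}{\partial x}\circ U_1'(t,x),\qquad\text{i.e. } \mathcal L_1^{(D)}(t)f=\tfrac12f''+\tfrac{D-1}{2}(U_1'f)',$$ $t\in[0,t_* )$, $x\in(0,2\pi r)$, the operator equality $$e^{(D-1)U_1(t,x)/2}\left[\frac{\partial}{\partial t}-\mathcal L_1^{(D)}(t)\right]e^{-(D-1)U_1(t,x)/2}=\frac{\partial}{\partial t}+\mathcal H_1^{(D)}(t)$$ holds, where $\mathcal H_1^{(D)}(t)=-\frac12\frac{\partial^2}{\partial x^2}+V_1^{(D)}(t,x)$ with $$V_1^{(D)}(t,x)=\frac{(D-1)(D-3)}{8}U_1'(t,x)^2=\frac{(D-1)(D-3)}{8}\left(U_1''(t,x)+2\dot U_1(t,x)\right),\qquad t\in[0,t_* ),\ x\in(0,2\pi r).$$ This potential is also written as $$V_1^{(D)}(t,x)=\frac{(D-1)(D-3)}{8}\left(\zeta(x|2\pi r,2\omega_3(t))-\frac{x}{\pi r}\eta_1(2\pi r,2\omega_3(t))\right)^2,\qquad t\in[0,t_* ),\ x\in(0,2\pi r).$$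
   Context: For $v\in\mathbb C$, $\Im\tau>0$: $\vartheta_1(v;\tau)=i\sum_{n\in\mathbb Z}(-1)^n e^{\pi i\tau(n-1/2)^2}e^{(2n-1)\pi i v}$. $2\omega_3(t)=\frac{i(t_*-t)}{r}$, $\tau(t)=\frac{i(t_*-t)}{2\pi r^2}$. $U_1(t,x)=-\log\vartheta_1\!\left(\frac{x}{2\pi r};\tau(t)\right)$, $t\in[0,t_* )$, $x\in(0,2\pi r)$; dot denotes $\partial/\partial t$, primes denote $\partial/\partial x$. Weierstrass zeta function with periods $2\omega_1,2\omega_3$, $\Omega_{m,n}=2m\omega_1+2n\omega_3$: $\zeta(z|2\omega_1,2\omega_3)=\frac1z+\sum_{(m,n)\ne(0,0)}\left[\frac1{z-\Omega_{m,n}}+\frac1{\Omega_{m,n}}+\frac z{\Omega_{m,n}^2}\right]$, and $\eta_1(2\omega_1,2\omega_3)=\zeta(\omega_1|2\omega_1,2\omega_3)$. Functions act as multiplication operators and the left-hand side is a composition of operators acting on smooth functions of $(t,x)$. *)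

theory Defs
  imports "HOL-Analysis.Analysis" "HOL-Library.Function_Algebras"
begin

definition theta1 :: "complex \<Rightarrow> complex \<Rightarrow> complex" where
  "theta1 v \<tau> = \<i> * (\<Sum>\<^sub>\<infinity>n::int. (-1) powi n
     * exp (of_real pi * \<i> * \<tau> * (of_int n - 1/2)^2)
     * exp ((2 * of_int n - 1) * of_real pi * \<i> * v))"

text \<open>The arguments \<open>p1\<close>, \<open>p3\<close> of the next two functions are the full periods
  \<open>2\<omega>\<^sub>1\<close>, \<open>2\<omega>\<^sub>3\<close>, so that \<open>\<eta>\<^sub>1\<close> is the value of \<open>\<zeta>\<close> at the half period \<open>p1/2\<close>.\<close>

definition weierstrass_zeta :: "complex \<Rightarrow> complex \<Rightarrow> complex \<Rightarrow> complex" where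
  "weierstrass_zeta z p1 p3 = 1 / z +
     (\<Sum>\<^sub>\<infinity>(m::int, n::int)\<in>UNIV - {(0, 0)}.
        let \<Omega> = of_int m * p1 + of_int n * p3 in 1 / (z - \<Omega>) + 1 / \<Omega> + z / \<Omega>^2)"

definition weierstrass_eta1 :: "complex \<Rightarrow> complex \<Rightarrow> complex" where
  "weierstrass_eta1 p1 p3 = weierstrass_zeta (p1 / 2) p1 p3"

definition period3 :: "real \<Rightarrow> real \<Rightarrow> real \<Rightarrow> complex" where
  "period3 r tstar t = \<i> * of_real (tstar - t) / of_real r"

definition tau :: "real \<Rightarrow> real \<Rightarrow> real \<Rightarrow> complex" where
  "tau r tstar t = \<i> * of_real (tstar - t) / of_real (2 * pi * r^2)"

text \<open>For \<open>t < tstar\<close> and \<open>0 < x < 2\<pi>r\<close> the value of \<open>\<vartheta>\<^sub>1\<close> below is a positive real number,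
  so the principal branch \<open>Ln\<close> is the real logarithm there.\<close>

definition U1 :: "real \<Rightarrow> real \<Rightarrow> real \<Rightarrow> real \<Rightarrow> complex" where
  "U1 r tstar t x = - Ln (theta1 (of_real (x / (2 * pi * r))) (tau r tstar t))"

type_synonym fld = "real \<Rightarrow> real \<Rightarrow> complex"

text \<open>The time derivative is taken within \<open>[0, tstar)\<close>: it is one-sided at \<open>t = 0\<close> and
  the ordinary derivative at the other times.\<close>

definition dt :: "real \<Rightarrow> fld \<Rightarrow> fld" where
  "dt tstar f = (\<lambda>t x. vector_derivative (\<lambda>s. f s x) (at t within {0..<tstar}))"

definition dx :: "fld \<Rightarrow> fld" where
  "dx f = (\<lambda>t x. vector_derivative (f t) (at x))"

definition mult_op :: "fld \<Rightarrow> fld \<Rightarrow> fld" where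
  "mult_op g f = (\<lambda>t x. g t x * f t x)"

text \<open>\<open>C\<^sup>k\<close> and smooth functions on \<open>[0, tstar) \<times> (0, 2\<pi>r)\<close>: all iterated partial
  derivatives, in any order, exist and are continuous there.\<close>

primrec Ck_on_strip :: "real \<Rightarrow> real \<Rightarrow> nat \<Rightarrow> fld \<Rightarrow> bool" where
  "Ck_on_strip r tstar 0 f \<longleftrightarrow>
     continuous_on ({0..<tstar} \<times> {0<..<2 * pi * r}) (\<lambda>(t, x). f t x)"
| "Ck_on_strip r tstar (Suc k) f \<longleftrightarrow>
     continuous_on ({0..<tstar} \<times> {0<..<2 * pi * r}) (\<lambda>(t, x). f t x) \<and>
     (\<forall>t\<in>{0..<tstar}. \<forall>x\<in>{0<..<2 * pi * r}.
        (\<lambda>s. f s x) differentiable (at t within {0..<tstar}) \<and> f t differentiable (at x)) \<and>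
     Ck_on_strip r tstar k (dt tstar f) \<and> Ck_on_strip r tstar k (dx f)"

definition smooth_on_strip :: "real \<Rightarrow> real \<Rightarrow> fld \<Rightarrow> bool" where
  "smooth_on_strip r tstar f \<longleftrightarrow> (\<forall>k. Ck_on_strip r tstar k f)"

definition L1 :: "real \<Rightarrow> real \<Rightarrow> real \<Rightarrow> fld \<Rightarrow> fld" where
  "L1 D r tstar f = (\<lambda>t x. 1/2 * dx (dx f) t x
     + of_real ((D - 1) / 2) * dx (mult_op (dx (U1 r tstar)) f) t x)"

definition V1 :: "real \<Rightarrow> real \<Rightarrow> real \<Rightarrow> fld" where
  "V1 D r tstar = (\<lambda>t x. of_real ((D - 1) * (D - 3) / 8) * (dx (U1 r tstar) t x)^2)"

definition H1 :: "real \<Rightarrow> real \<Rightarrow> real \<Rightarrow> fld \<Rightarrow> fld" where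
  "H1 D r tstar f = (\<lambda>t x. - 1/2 * dx (dx f) t x + V1 D r tstar t x * f t x)"

end

theory Submission
  imports Defs
begin

text \<open>Conjugating by \<open>exp (- (D - 1) U / 2)\<close> turns the Kolmogorov operator into a Schroedinger
  operator whose potential is a combination of \<open>U'\<^sup>2\<close> and \<open>U'' + 2 \<partial>\<^sub>t U\<close>; the two coincide because
  \<open>\<vartheta>\<^sub>1\<close> solves a heat equation and \<open>U = - log \<vartheta>\<^sub>1\<close>.

  For the Weierstrass form of the potential, the finite Jacobi triple product writes the partial
  products of \<open>\<vartheta>\<^sub>1\<close> as trigonometric sums. Applying Tannery's theorem to these sums and to their
  term-by-term derivatives shows that \<open>\<vartheta>\<^sub>1\<close> is positive and gives its logarithmic derivative as a
  sum of cotangents over the rows of the lattice. On the other side, averaging the series of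
  \<open>\<zeta>\<close> over \<open>\<Omega>\<close> and \<open>- \<Omega>\<close> and summing each row by the partial fractions of the cotangent gives
  the same cotangents plus a multiple of \<open>x\<close>. At the half period the cotangents cancel, so that
  multiple is determined by \<open>\<eta>\<^sub>1\<close>.\<close>

section \<open>The finite Jacobi triple product\<close>

text \<open>The q-Pochhammer symbol \<open>(q^2; q^2)_n\<close>.\<close>

definition qpoch :: "real \<Rightarrow> nat \<Rightarrow> real" where
  "qpoch q n = (\<Prod>k<n. 1 - q ^ (2 * Suc k))"

text \<open>The extension by \<open>0\<close> to negative indices makes the recurrence \<open>inv_qpoch_minus_1\<close> valid for
  all integers, so that the recurrence for the coefficients has no boundary cases.\<close>

definition inv_qpoch :: "real \<Rightarrow> int \<Rightarrow> real" where
  "inv_qpoch q k = (if k < 0 then 0 else 1 / qpoch q (nat k))"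

text \<open>The Gaussian binomial coefficient \<open>2 * N + 1\<close> over \<open>N - n\<close>
  with base \<open>q^2\<close>. It vanishes unless \<open>- N - 1 \<le> n \<le> N\<close>.\<close>

definition jtp_coeff :: "real \<Rightarrow> nat \<Rightarrow> int \<Rightarrow> real" where
  "jtp_coeff q N n = qpoch q (2 * N + 1) * inv_qpoch q (int N - n) * inv_qpoch q (int N + 1 + n)"

lemma one_minus_power_pos: "0 < q \<Longrightarrow> q < 1 \<Longrightarrow> 0 < 1 - (q::real) ^ (2 * Suc k)"
  by (simp add: power_less_one_iff del: power_Suc mult_Suc_right)

lemma qpoch_pos: "0 < q \<Longrightarrow> q < 1 \<Longrightarrow> qpoch q n > 0"
  unfolding qpoch_def by (intro prod_pos) (blast intro: one_minus_power_pos)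

lemma qpoch_Suc: "qpoch q (Suc n) = qpoch q n * (1 - q ^ (2 * Suc n))"
  by (simp add: qpoch_def)

lemma inv_qpoch_of_nat: "inv_qpoch q (int k) = 1 / qpoch q k"
  by (simp add: inv_qpoch_def)

text \<open>At \<open>k = 0\<close> the factor \<open>1 - q powi (2 * k)\<close> is
  \<open>0\<close>, which matches the value \<open>0\<close> chosen for the index
  \<open>-1\<close>.\<close>

lemma inv_qpoch_minus_1:
  assumes "0 < q" "q < 1"
  shows "inv_qpoch q (k - 1) = (1 - q powi (2 * k)) * inv_qpoch q k"
proof (cases "k > 0")
  case True
  then obtain m where m: "k = int (Suc m)"
    by (metis Suc_pred nat_0_le zero_less_nat_eq order_less_imp_le)
  have k1: "k - 1 = int m"
    using m by simp
  have "q powi (2 * k) = q ^ (2 * Suc m)"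
    unfolding m by (metis of_nat_mult of_nat_numeral power_int_of_nat)
  moreover have "1 - q ^ (2 * Suc m) \<noteq> 0"
    using one_minus_power_pos[of q m] assms by simp
  moreover have "inv_qpoch q (k - 1) = 1 / qpoch q m" "inv_qpoch q k = 1 / qpoch q (Suc m)"
    unfolding inv_qpoch_def k1 by (simp_all add: m del: of_nat_Suc)
  ultimately show ?thesis
    by (simp add: qpoch_Suc)
qed (auto simp: inv_qpoch_def)

text \<open>This is the effect on the coefficients of multiplying the sine sum by
  \<open>1 - 2 * R * cos (2 * \<phi>) + R^2\<close> with \<open>R = q ^ (2 * N + 2)\<close>; the
  alternating signs of the sum turn the minus into a plus. Writing all four coefficients through the
  common factors \<open>u\<close> and \<open>v\<close> leaves an identity in \<open>X\<close> and
  \<open>Y\<close>.\<close>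

lemma jtp_coeff_step:
  assumes q: "0 < q" "q < 1"
  shows "jtp_coeff q (Suc N) n * q powi (n * (n + 1)) =
    (1 + q ^ (4 * N + 4)) * (jtp_coeff q N n * q powi (n * (n + 1)))
    + q ^ (2 * N + 2) * (jtp_coeff q N (n - 1) * q powi ((n - 1) * n)
                         + jtp_coeff q N (n + 1) * q powi ((n + 1) * (n + 2)))"
proof -
  define u v where "u = inv_qpoch q (int N + 1 - n)" and "v = inv_qpoch q (int N + 2 + n)"
  define X Y where "X = q powi (2 * (int N + 1 - n))" and "Y = q powi (2 * (int N + 1 + n))"
  have q0: "q \<noteq> 0" using q by simp
  have add: "q powi k * q powi l = q powi m" if "m = k + l" for k l m
    using q0 that by (simp add: power_int_add)
  have N: "q ^ k = q powi (int k)" for k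
    by simp
  have Q: "q powi (2 * (int N - n)) = X / q^2" "q powi (2 * (int N + 2 + n)) = Y * q^2"
    unfolding X_def Y_def N nonzero_eq_divide_eq[OF power_not_zero[OF q0], of _ _ 2, unfolded N]
    by (subst add; simp)+
  have i: "inv_qpoch q (int N - n) = (1 - X) * u"
          "inv_qpoch q (int N - n - 1) = (1 - X / q^2) * ((1 - X) * u)"
          "inv_qpoch q (int N + 1 + n) = (1 - Y * q^2) * v"
          "inv_qpoch q (int N + n) = (1 - Y) * ((1 - Y * q^2) * v)"
  proof -
    have *: "inv_qpoch q l = (1 - q powi (2 * k)) * inv_qpoch q k" if "l = k - 1" for k l
      using inv_qpoch_minus_1[OF q] that by simp
    show i1: "inv_qpoch q (int N - n) = (1 - X) * u"
      unfolding X_def u_def by (rule *) simp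
    show "inv_qpoch q (int N - n - 1) = (1 - X / q^2) * ((1 - X) * u)"
      unfolding i1[symmetric] Q[symmetric] by (rule *) simp
    show i2: "inv_qpoch q (int N + 1 + n) = (1 - Y * q^2) * v"
      unfolding Q[symmetric] v_def by (rule *) simp
    show "inv_qpoch q (int N + n) = (1 - Y) * ((1 - Y * q^2) * v)"
      unfolding i2[symmetric] unfolding Y_def by (rule *) simp
  qed
  have XY: "q ^ (4 * N + 4) = X * Y" 
    unfolding X_def Y_def N by (subst add; simp)
  have T1: "q ^ (2 * N + 2) * q powi ((n - 1) * n) = X * q powi (n * (n + 1))"
    unfolding X_def N by (simp only: add[OF refl]) (simp add: algebra_simps)
  have T2: "q ^ (2 * N + 2) * q powi ((n + 1) * (n + 2)) = Y * q^2 * q powi (n * (n + 1))"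
    unfolding Y_def N by (simp only: add[OF refl]) (simp add: algebra_simps)
  have P: "qpoch q (2 * Suc N + 1) = qpoch q (2 * N + 1) * (1 - X * Y) * (1 - X * Y * q^2)"
    by (simp add: qpoch_Suc XY[symmetric] power_add eval_nat_numeral algebra_simps)
  \<comment> \<open>What remains of the recurrence once \<open>qpoch q (2 * N + 1) * u * v\<close>
    and the power of \<open>q\<close> are factored out.\<close>
  have key: "(1 - X * Y) * (1 - X * Y * q^2) = (1 + X * Y) * ((1 - X) * (1 - Y * q^2))
        + X * ((1 - Y) * (1 - Y * q^2)) + Y * q^2 * ((1 - X / q^2) * (1 - X))"
    using q0 by (simp add: field_simps)
  have "jtp_coeff q (Suc N) n = qpoch q (2 * N + 1) * ((1 - X * Y) * (1 - X * Y * q^2)) * u * v"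
    unfolding jtp_coeff_def P by (simp add: u_def v_def algebra_simps)
  moreover have "jtp_coeff q N n = qpoch q (2 * N + 1) * ((1 - X) * u) * ((1 - Y * q^2) * v)"
    unfolding jtp_coeff_def i by simp
  moreover have "jtp_coeff q N (n - 1) = qpoch q (2 * N + 1) * u * ((1 - Y) * ((1 - Y * q^2) * v))"
    unfolding jtp_coeff_def i(4)[symmetric] u_def by (simp add: algebra_simps)
  moreover have "jtp_coeff q N (n + 1) = qpoch q (2 * N + 1) * ((1 - X / q^2) * ((1 - X) * u)) * v"
    unfolding jtp_coeff_def i(2)[symmetric] v_def by (simp add: algebra_simps)
  moreover have "q ^ (2 * N + 2) * (a * q powi ((n - 1) * n) + b * q powi ((n + 1) * (n + 2)))
      = (a * X + b * (Y * q^2)) * q powi (n * (n + 1))" for a b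
  proof -
    have *: "c * (a * A + b * B) = a * (c * A) + b * (c * B)" for c A B :: real
      by (simp only: ring_distribs mult_ac)
    show ?thesis
      unfolding * T1 T2 by (rule trans[OF _ distrib_right[symmetric]]) (simp only: mult_ac)
  qed
  ultimately show ?thesis
    unfolding XY key by (simp only:) (simp add: distrib_right distrib_left mult_ac)
qed

text \<open>An index shift moves the neighbours from the sines to the coefficients. The boundary
  term at the lower end cancels because \<open>s (-1) = - s 0\<close> and
  \<open>a (-1) = a 0\<close>; the one at \<open>M\<close> is kept explicitly.\<close>

lemma sum_odd_sines:
  fixes a :: "int \<Rightarrow> real" and \<phi> :: real
  defines "s \<equiv> \<lambda>k::int. sin ((2 * of_int k + 1) * \<phi>)"
  assumes "a (-1) = a 0"
  shows "(\<Sum>n<M. (-1)^n * a (int n) * (s (int n + 1) + s (int n - 1))) =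
    - (\<Sum>n<M. (-1)^n * (a (int n - 1) + a (int n + 1)) * s (int n))
    - (-1)^M * (a (int M - 1) * s (int M) + a (int M) * s (int M - 1))"
proof (induction M)
  case 0
  have "s (-1) = - s 0"
    by (simp add: s_def)
  then show ?case
    using assms by (simp add: algebra_simps)
next
  case (Suc M)
  then show ?case
    by (simp add: algebra_simps)
qed

lemma jtp_coeff_eq_0: "N < n \<Longrightarrow> jtp_coeff q N (int n) = 0"
  by (simp add: jtp_coeff_def inv_qpoch_def)

lemma jtp_coeff_minus_1: "jtp_coeff q N (-1) = jtp_coeff q N 0"
  by (simp add: jtp_coeff_def add.commute)

text \<open>Induction on the number of factors by \<open>jtp_coeff_step\<close>. Coefficients beyond
  \<open>N\<close> vanish, so the upper limit \<open>M\<close> may be any number above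
  \<open>N\<close>, and the same \<open>M\<close> serves for \<open>N\<close> and
  \<open>Suc N\<close>.\<close>

lemma finite_jacobi_triple_product:
  assumes q: "0 < q" "q < 1" and "N < M"
  shows "sin \<phi> * (\<Prod>k<N. 1 - 2 * q ^ (2 * Suc k) * cos (2 * \<phi>) + (q ^ (2 * Suc k))\<^sup>2) =
    (\<Sum>n<M. (-1)^n * (jtp_coeff q N (int n) * q ^ (n * (n + 1))) * sin ((2 * real n + 1) * \<phi>))"
  using \<open>N < M\<close>
proof (induction N)
  case 0
  then obtain M' where M: "M = Suc M'"
    by (cases M) auto
  have "qpoch q 1 * inv_qpoch q 0 * inv_qpoch q 1 = 1"
    using qpoch_pos[OF q, of 1] by (simp add: inv_qpoch_def qpoch_def)
  moreover have "jtp_coeff q 0 (1 + int n) = 0" for n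
    using jtp_coeff_eq_0[of 0 "Suc n"] by simp
  ultimately show ?case
    unfolding M sum.lessThan_Suc_shift by (simp add: jtp_coeff_def[of _ _ 0])
next
  case (Suc N)
  define s where "s = (\<lambda>k::int. sin ((2 * of_int k + 1) * \<phi>))"
  define a where "a = (\<lambda>n::int. jtp_coeff q N n * q powi (n * (n + 1)))"
  define R where "R = q ^ (2 * Suc N)"
  have R2: "R\<^sup>2 = q ^ (4 * N + 4)"
  proof -
    have "2 * Suc N * 2 = 4 * N + 4"
      by simp
    then show ?thesis
      by (simp only: R_def flip: power_mult)
  qed
  have sc: "2 * cos (2 * \<phi>) * s k = s (k + 1) + s (k - 1)" for k
  proof -
    have "s (k + 1) = sin ((2 * of_int k + 1) * \<phi> + 2 * \<phi>)"
         "s (k - 1) = sin ((2 * of_int k + 1) * \<phi> - 2 * \<phi>)"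
      by (simp_all add: s_def algebra_simps)
    then show ?thesis
      by (simp add: s_def sin_add sin_diff)
  qed
  have pw: "q powi (int n * (int n + 1)) = q ^ (n * (n + 1))" for n
  proof -
    have "int n * (int n + 1) = int (n * (n + 1))"
      by (simp add: algebra_simps)
    then show ?thesis
      by (simp only: power_int_of_nat)
  qed
  have a0: "a (int n) = 0" if "N < n" for n
    using that by (simp add: a_def jtp_coeff_eq_0)
  have a1: "a (-1) = a 0"
    by (simp add: a_def jtp_coeff_minus_1)
  have "sin \<phi> * (\<Prod>k<Suc N. 1 - 2 * q ^ (2 * Suc k) * cos (2 * \<phi>) + (q ^ (2 * Suc k))\<^sup>2)
    = (sin \<phi> * (\<Prod>k<N. 1 - 2 * q ^ (2 * Suc k) * cos (2 * \<phi>) + (q ^ (2 * Suc k))\<^sup>2))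
      * (1 + R\<^sup>2 - R * (2 * cos (2 * \<phi>)))"
    by (simp only: prod.lessThan_Suc R_def[symmetric]) (simp add: algebra_simps)
  also have "sin \<phi> * (\<Prod>k<N. 1 - 2 * q ^ (2 * Suc k) * cos (2 * \<phi>) + (q ^ (2 * Suc k))\<^sup>2)
    = (\<Sum>n<M. (-1)^n * a (int n) * s (int n))"
    using Suc.IH Suc.prems by (simp only: a_def s_def pw of_int_of_nat_eq Suc_lessD)
  also have "\<dots> * (1 + R\<^sup>2 - R * (2 * cos (2 * \<phi>))) =
    (1 + R\<^sup>2) * (\<Sum>n<M. (-1)^n * a (int n) * s (int n))
    - R * (\<Sum>n<M. (-1)^n * a (int n) * (2 * cos (2 * \<phi>) * s (int n)))"
    unfolding sum_distrib_left sum_distrib_right sum_subtractf[symmetric]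
    by (intro sum.cong refl) (simp add: algebra_simps)
  also have "(\<Sum>n<M. (-1)^n * a (int n) * (2 * cos (2 * \<phi>) * s (int n)))
    = - (\<Sum>n<M. (-1)^n * (a (int n - 1) + a (int n + 1)) * s (int n))"
  proof -
    \<comment> \<open>Since \<open>N < M - 1\<close>, both boundary terms of the index shift
      vanish.\<close>
    have "a (int M) = 0" "a (int M - 1) = 0"
      using a0[of M] a0[of "M - 1"] Suc.prems by (simp_all add: of_nat_diff)
    then show ?thesis
      unfolding sc unfolding s_def by (subst sum_odd_sines[where a = a, OF a1]) simp
  qed
  also have "(1 + R\<^sup>2) * (\<Sum>n<M. (-1)^n * a (int n) * s (int n)) - R * \<dots>
    = (\<Sum>n<M. (-1)^n * ((1 + R\<^sup>2) * a (int n) + R * (a (int n - 1) + a (int n + 1))) * s (int n))"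
    unfolding mult_minus_right diff_minus_eq_add sum_distrib_left sum.distrib[symmetric]
    by (intro sum.cong refl) (simp add: algebra_simps)
  also have "\<dots> = (\<Sum>n<M. (-1)^n * (jtp_coeff q (Suc N) (int n) * q ^ (n * (n + 1)))
      * sin ((2 * real n + 1) * \<phi>))"
  proof (intro sum.cong refl)
    fix n
    have "jtp_coeff q (Suc N) (int n) * q powi (int n * (int n + 1)) =
      (1 + R\<^sup>2) * a (int n) + R * (a (int n - 1) + a (int n + 1))"
      unfolding R2 unfolding a_def R_def using jtp_coeff_step[OF q, of N "int n"]
      by (simp add: add.assoc)
    then show "(-1)^n * ((1 + R\<^sup>2) * a (int n) + R * (a (int n - 1) + a (int n + 1))) * s (int n)
      = (-1)^n * (jtp_coeff q (Suc N) (int n) * q ^ (n * (n + 1))) * sin ((2 * real n + 1) * \<phi>)"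
      by (simp only: s_def pw of_int_of_nat_eq)
  qed
  finally show ?case .
qed

section \<open>Passage to infinitely many factors\<close>

text \<open>The infinite product converges absolutely and has no zero factor, so its limit is
  nonzero; monotonicity makes the limit a lower bound for all partial products. This positive bound
  later dominates the coefficients uniformly.\<close>

lemma qpoch_limit:
  assumes q: "0 < q" "q < 1"
  obtains p where "p > 0" "qpoch q \<longlonglongrightarrow> p" "\<And>n. p \<le> qpoch q n" "\<And>n. qpoch q n \<le> 1"
proof -
  have nz: "1 - q ^ (2 * Suc k) \<noteq> 0" for k
    using one_minus_power_pos[OF q, of k] by simp
  have "summable (\<lambda>k. (q\<^sup>2) ^ k * q\<^sup>2)"
    using q by (intro summable_mult2 summable_geometric) (simp add: power_less_one_iff)
  then have "summable (\<lambda>k. q ^ (2 * Suc k))"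
    by (simp only: power_mult power_Suc2)
  then have "summable (\<lambda>k. norm ((1 - q ^ (2 * Suc k)) - 1))"
    using q by simp
  from summable_imp_abs_convergent_prod[OF this]
  have "convergent_prod (\<lambda>k. 1 - q ^ (2 * Suc k))"
    by (rule abs_convergent_prod_imp_convergent_prod)
  then obtain p where "(\<lambda>n. \<Prod>k\<le>n. 1 - q ^ (2 * Suc k)) \<longlonglongrightarrow> p" and p0: "p \<noteq> 0"
    using convergent_prod_iff_nz_lim[of "\<lambda>k. 1 - q ^ (2 * Suc k)"] nz by auto
  then have "(\<lambda>n. qpoch q (Suc n)) \<longlonglongrightarrow> p"
    by (simp only: qpoch_def lessThan_Suc_atMost)
  then have lim: "qpoch q \<longlonglongrightarrow> p"
    by (simp only: filterlim_sequentially_Suc)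
  have dec: "decseq (qpoch q)"
  proof (rule decseq_SucI)
    show "qpoch q (Suc n) \<le> qpoch q n" for n
      unfolding qpoch_Suc using qpoch_pos[OF q, of n] one_minus_power_pos[OF q, of n] q
      by (intro mult_left_le) auto
  qed
  have "p \<ge> 0"
    by (rule LIMSEQ_le_const[OF lim]) (use qpoch_pos[OF q] less_imp_le in blast)
  moreover have "qpoch q n \<le> 1" for n
    using decseqD[OF dec, of 0 n] by (simp add: qpoch_def)
  ultimately show ?thesis
    using that[of p] p0 lim decseq_ge[OF dec lim] by simp
qed

lemma jtp_coeff_tendsto:
  assumes q: "0 < q" "q < 1" and p: "p > 0" "qpoch q \<longlonglongrightarrow> p"
  shows "(\<lambda>N. jtp_coeff q N (int n)) \<longlonglongrightarrow> 1 / p"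
proof -
  \<comment> \<open>Replacing \<open>N\<close> by \<open>N + n\<close> makes every index a natural
    number; \<open>LIMSEQ_offset\<close> undoes the shift.\<close>
  have "(\<lambda>N. qpoch q (2 * (N + n) + 1)) \<longlonglongrightarrow> p" "(\<lambda>N. qpoch q N) \<longlonglongrightarrow> p"
       "(\<lambda>N. qpoch q (N + n + 1 + n)) \<longlonglongrightarrow> p"
    by (rule filterlim_compose[OF p(2)], real_asymp)+
  then have "(\<lambda>N. qpoch q (2 * (N + n) + 1) * (1 / qpoch q N) * (1 / qpoch q (N + n + 1 + n)))
      \<longlonglongrightarrow> p * (1 / p) * (1 / p)"
    using p by (intro tendsto_intros) auto
  moreover have "jtp_coeff q (N + n) (int n) =
      qpoch q (2 * (N + n) + 1) * (1 / qpoch q N) * (1 / qpoch q (N + n + 1 + n))" for N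
  proof -
    have "int (N + n) - int n = int N" "int (N + n) + 1 + int n = int (N + n + 1 + n)"
      by simp_all
    then show ?thesis
      unfolding jtp_coeff_def by (simp only: inv_qpoch_of_nat)
  qed
  ultimately have "(\<lambda>N. jtp_coeff q (N + n) (int n)) \<longlonglongrightarrow> 1 / p"
    using p by simp
  then show ?thesis
    by (rule LIMSEQ_offset)
qed

text \<open>The coefficients converge to \<open>1 / p\<close> and are bounded independently of
  \<open>N\<close> and \<open>n\<close>, so Tannery's theorem applies. Leaving \<open>s\<close>
  general covers both the sines and their derivatives.\<close>

lemma jtp_tannery:
  assumes q: "0 < q" "q < 1" and p: "p > 0" "qpoch q \<longlonglongrightarrow> p"
    and summable: "summable (\<lambda>n. \<bar>q ^ (n * (n + 1)) * s n\<bar>)"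
  shows "(\<lambda>N. \<Sum>n<Suc N. (-1)^n * (jtp_coeff q N (int n) * q ^ (n * (n + 1))) * s n)
    \<longlonglongrightarrow> (\<Sum>n. (-1)^n * q ^ (n * (n + 1)) * s n) / p"
proof -
  obtain p' where p': "p' > 0" "\<And>n. p' \<le> qpoch q n" "\<And>n. qpoch q n \<le> 1"
    using qpoch_limit[OF q] by metis
  define F where "F = (\<lambda>n N. (-1)^n * (jtp_coeff q N (int n) * q ^ (n * (n + 1))) * s n)"
  have ic: "0 \<le> inv_qpoch q k \<and> inv_qpoch q k \<le> 1 / p'" for k
    using p'(1) p'(2)[of "nat k"] qpoch_pos[OF q, of "nat k"]
    by (auto simp: inv_qpoch_def intro!: divide_left_mono)
  have bound: "\<bar>jtp_coeff q N k\<bar> \<le> 1 * (1 / p') * (1 / p')" for N k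
    unfolding jtp_coeff_def abs_mult using ic p'(3) qpoch_pos[OF q] p'(1)
    by (intro mult_mono) (auto simp: less_imp_le)
  have "(\<lambda>N. suminf (\<lambda>n. F n N)) \<longlonglongrightarrow> (\<Sum>n. (-1)^n * (1 / p * q ^ (n * (n + 1))) * s n)"
  proof (rule tannerys_theorem[THEN conjunct2, THEN conjunct2])
    show "(\<lambda>N. F n N) \<longlonglongrightarrow> (-1)^n * (1 / p * q ^ (n * (n + 1))) * s n" for n
      unfolding F_def by (intro tendsto_intros jtp_coeff_tendsto q p)
    show "summable (\<lambda>n. 1 / p' * (1 / p') * \<bar>q ^ (n * (n + 1)) * s n\<bar>)"
      using summable by (rule summable_mult)
    show "eventually (\<lambda>(n, N). norm (F n N) \<le> 1 / p' * (1 / p') * \<bar>q ^ (n * (n + 1)) * s n\<bar>)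
        (at_top \<times>\<^sub>F sequentially)"
    proof (intro always_eventually allI, clarify)
      fix n N
      show "norm (F n N) \<le> 1 / p' * (1 / p') * \<bar>q ^ (n * (n + 1)) * s n\<bar>"
        using mult_right_mono[OF bound[of N "int n"], of "\<bar>q ^ (n * (n + 1)) * s n\<bar>"]
        by (simp add: F_def abs_mult power_abs mult_ac)
    qed
  qed simp
  \<comment> \<open>The finite sums are series, because the coefficients vanish for
    \<open>n > N\<close>.\<close>
  moreover have "suminf (\<lambda>n. F n N) = (\<Sum>n<Suc N. F n N)" for N
    by (rule suminf_finite) (auto simp: F_def jtp_coeff_eq_0)
  moreover have "(\<Sum>n. (-1)^n * (1 / p * q ^ (n * (n + 1))) * s n)
      = (\<Sum>n. (-1)^n * q ^ (n * (n + 1)) * s n) / p"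
  proof -
    have "summable (\<lambda>n. (-1)^n * q ^ (n * (n + 1)) * s n)"
      by (rule summable_rabs_cancel) (use summable in \<open>simp add: abs_mult\<close>)
    from suminf_divide[OF this, of p] show ?thesis
      by (simp add: field_simps)
  qed
  ultimately show ?thesis
    by (simp add: F_def)
qed

section \<open>The theta function as a sine series\<close>

text \<open>Half of \<open>theta1\<close> on the imaginary axis: for
  \<open>\<tau> = \<i> * s\<close> the parameters are \<open>a = pi * s / 4\<close> and
  \<open>\<phi> = pi * v\<close>, and the nome is \<open>exp (- 4 * a)\<close>.\<close>

definition jtheta :: "real \<Rightarrow> real \<Rightarrow> real" where
  "jtheta a \<phi> = (\<Sum>n. (-1)^n * exp (- a * (2 * real n + 1)\<^sup>2) * sin ((2 * real n + 1) * \<phi>))"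

definition jtheta_deriv :: "real \<Rightarrow> real \<Rightarrow> real" where
  "jtheta_deriv a \<phi> = (\<Sum>n. (-1)^n * exp (- a * (2 * real n + 1)\<^sup>2) *
     ((2 * real n + 1) * cos ((2 * real n + 1) * \<phi>)))"

definition jtheta_deriv2 :: "real \<Rightarrow> real \<Rightarrow> real" where
  "jtheta_deriv2 a \<phi> = (\<Sum>n. (-1)^n * exp (- a * (2 * real n + 1)\<^sup>2) *
     (- (2 * real n + 1)\<^sup>2 * sin ((2 * real n + 1) * \<phi>)))"

text \<open>The weight \<open>(2 * real n + 1)^2\<close> is the one produced by two derivatives in
  \<open>\<phi>\<close>, so a single majorant serves the series and all its derivatives
  below.\<close>

lemma summable_gauss:
  assumes "a > 0"
  shows "summable (\<lambda>n. exp (- a * (2 * real n + 1)\<^sup>2) * (2 * real n + 1)\<^sup>2)"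
proof (rule summable_comparison_test_bigo)
  show "summable (\<lambda>n. norm (1 / real n ^ 2))"
    using inverse_power_summable[of 2, where 'a = real] by (simp add: field_simps)
  show "(\<lambda>n. exp (- a * (2 * real n + 1)\<^sup>2) * (2 * real n + 1)\<^sup>2) \<in> O(\<lambda>n. 1 / real n ^ 2)"
    using assms by real_asymp
qed

lemma one_le_odd_square: "1 \<le> (2 * real n + 1)\<^sup>2"
  by (rule one_le_power) simp

lemma odd_le_square: "2 * real n + 1 \<le> (2 * real n + 1)\<^sup>2"
  by (rule self_le_power) simp_all

lemma gauss_mult_le:
  assumes "a0 \<le> a" "\<bar>c\<bar> \<le> (2 * real n + 1)\<^sup>2"
  shows "\<bar>(-1)^n * exp (- a * (2 * real n + 1)\<^sup>2) * c\<bar> \<le> exp (- a0 * (2 * real n + 1)\<^sup>2) * (2 * real n + 1)\<^sup>2"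
proof -
  have "exp (- a * (2 * real n + 1)\<^sup>2) \<le> exp (- a0 * (2 * real n + 1)\<^sup>2)"
    using assms(1) by (simp add: mult_right_mono)
  then show ?thesis
    using assms(2) by (simp add: abs_mult mult_mono)
qed

lemma summable_gauss_mult:
  assumes "a > 0" "\<And>n. \<bar>c n\<bar> \<le> (2 * real n + 1)\<^sup>2"
  shows "summable (\<lambda>n. \<bar>(-1)^n * exp (- a * (2 * real n + 1)\<^sup>2) * c n\<bar>)"
  by (rule summable_comparison_test'[OF summable_gauss[OF assms(1)]])
     (use gauss_mult_le[OF order_refl assms(2)] in simp)

lemma odd_trig_bounds:
  "\<bar>sin x\<bar> \<le> (2 * real n + 1)\<^sup>2"
  "\<bar>(2 * real n + 1) * cos x\<bar> \<le> (2 * real n + 1)\<^sup>2"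
  "\<bar>- (2 * real n + 1)\<^sup>2 * sin x\<bar> \<le> (2 * real n + 1)\<^sup>2"
proof -
  show "\<bar>sin x\<bar> \<le> (2 * real n + 1)\<^sup>2"
    using abs_sin_le_one[of x] one_le_odd_square[of n] by linarith
  show "\<bar>(2 * real n + 1) * cos x\<bar> \<le> (2 * real n + 1)\<^sup>2"
  proof -
    have "\<bar>(2 * real n + 1) * cos x\<bar> = (2 * real n + 1) * \<bar>cos x\<bar>"
      by (simp add: abs_mult)
    also have "\<dots> \<le> (2 * real n + 1) * 1"
      by (intro mult_left_mono abs_cos_le_one) simp
    also have "\<dots> \<le> (2 * real n + 1)\<^sup>2"
      using odd_le_square[of n] by simp
    finally show ?thesis .
  qed
  show "\<bar>- (2 * real n + 1)\<^sup>2 * sin x\<bar> \<le> (2 * real n + 1)\<^sup>2"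
    using mult_left_mono[OF abs_sin_le_one[of x], of "(2 * real n + 1)\<^sup>2"]
    by (simp add: abs_mult)
qed

lemma
  assumes "a > 0"
  shows has_real_derivative_jtheta: "(jtheta a has_real_derivative jtheta_deriv a \<phi>) (at \<phi>)"
    and has_real_derivative_jtheta_deriv:
      "(jtheta_deriv a has_real_derivative jtheta_deriv2 a \<phi>) (at \<phi>)"
proof -
  let ?e = "\<lambda>n. (-1)^n * exp (- a * (2 * real n + 1)\<^sup>2)"
  \<comment> \<open>Termwise differentiation by the Weierstrass M-test, for any factors bounded by
    the weight; it is applied once to the sines and once to their derivatives.\<close>
  have *: "((\<lambda>x. \<Sum>n. ?e n * f n x) has_real_derivative (\<Sum>n. ?e n * f' n \<phi>)) (at \<phi>)"
    if "\<And>n x. (f n has_real_derivative f' n x) (at x)"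
       "\<And>n x. \<bar>f n x\<bar> \<le> (2 * real n + 1)\<^sup>2" "\<And>n x. \<bar>f' n x\<bar> \<le> (2 * real n + 1)\<^sup>2" for f f' :: "nat \<Rightarrow> real \<Rightarrow> real"
  proof (rule has_field_derivative_series'(2)
      [where S = UNIV and ?x0.0 = 0 and f = "\<lambda>n x. ?e n * f n x" and f' = "\<lambda>n x. ?e n * f' n x"])
    show "uniformly_convergent_on UNIV (\<lambda>n x. \<Sum>i<n. ?e i * f' i x)"
      by (rule Weierstrass_m_test'[OF _ summable_gauss[OF assms]])
         (simp only: real_norm_def, rule gauss_mult_le[OF order_refl that(3)])
    show "summable (\<lambda>n. ?e n * f n 0)"
      by (rule summable_rabs_cancel[OF summable_gauss_mult[OF assms that(2)]])
  qed (auto intro!: DERIV_cmult that(1))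
  show "(jtheta a has_real_derivative jtheta_deriv a \<phi>) (at \<phi>)"
    unfolding jtheta_def [abs_def] jtheta_deriv_def
    by (rule * [OF _ odd_trig_bounds(1,2)]) (auto intro!: derivative_eq_intros)
  show "(jtheta_deriv a has_real_derivative jtheta_deriv2 a \<phi>) (at \<phi>)"
    unfolding jtheta_deriv_def [abs_def] jtheta_deriv2_def
    by (rule * [OF _ odd_trig_bounds(2,3)])
       (auto intro!: derivative_eq_intros simp: power2_eq_square)
qed

text \<open>Differentiating the Gaussian factor in \<open>a\<close> yields the same factor
  \<open>- (2 * real n + 1)^2\<close> as two derivatives of the sine. The majorant needs a positive
  lower bound on the parameter, hence the set \<open>{a/2..}\<close>.\<close>

lemma heat_equation_jtheta:
  assumes "a > 0"
  shows "((\<lambda>a. jtheta a \<phi>) has_real_derivative jtheta_deriv2 a \<phi>) (at a)"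
  unfolding jtheta_def jtheta_deriv2_def
proof (rule has_field_derivative_series'(2)[where S = "{a/2..}" and ?x0.0 = a])
  let ?f' = "\<lambda>n x. (-1)^n * exp (- x * (2 * real n + 1)\<^sup>2) * (- (2 * real n + 1)\<^sup>2 * sin ((2 * real n + 1) * \<phi>))"
  show "uniformly_convergent_on {a/2..} (\<lambda>n x. \<Sum>i<n. ?f' i x)"
    by (rule Weierstrass_m_test'[OF _ summable_gauss[of "a / 2"]])
       (use assms gauss_mult_le[OF _ odd_trig_bounds(3), of "a/2"] in auto)
  show "summable (\<lambda>n. (-1)^n * exp (- a * (2 * real n + 1)\<^sup>2) * sin ((2 * real n + 1) * \<phi>))"
    by (rule summable_rabs_cancel[OF summable_gauss_mult[OF assms odd_trig_bounds(1)]])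
  show "((\<lambda>x. (-1)^n * exp (- x * (2 * real n + 1)\<^sup>2) * sin ((2 * real n + 1) * \<phi>))
      has_real_derivative ?f' n x) (at x within {a/2..})" for n x
    by (auto intro!: derivative_eq_intros)
qed (use assms in auto)

text \<open>From \<open>(2 * n + 1)^2 = 4 * n * (n + 1) + 1\<close>; this identifies
  \<open>q\<close> with \<open>exp (- 4 * a)\<close>.\<close>

lemma gauss_odd_square: "exp (- a * (2 * real n + 1)\<^sup>2) = exp (- a) * exp (- 4 * a) ^ (n * (n + 1))"
proof -
  have "- a * (2 * real n + 1)\<^sup>2 = - a + real (n * (n + 1)) * (- 4 * a)"
    by (simp add: power2_eq_square algebra_simps)
  then show ?thesis
    by (simp only: exp_add exp_of_nat_mult)
qed

lemma jtp_tannery_jtheta: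
  assumes "a > 0" and p: "p > 0" "qpoch (exp (- 4 * a)) \<longlonglongrightarrow> p"
    and "\<And>n. \<bar>s n\<bar> \<le> (2 * real n + 1)\<^sup>2"
  defines "q \<equiv> exp (- 4 * a)"
  shows "(\<lambda>N. \<Sum>n<Suc N. (-1)^n * (jtp_coeff q N (int n) * q ^ (n * (n + 1))) * s n)
    \<longlonglongrightarrow> exp a / p * (\<Sum>n. (-1)^n * exp (- a * (2 * real n + 1)\<^sup>2) * s n)"
proof -
  have e: "q ^ (n * (n + 1)) = exp a * exp (- a * (2 * real n + 1)\<^sup>2)" for n
    unfolding gauss_odd_square q_def by (simp flip: exp_add mult.assoc)
  have sums: "summable (\<lambda>n. \<bar>(-1)^n * exp (- a * (2 * real n + 1)\<^sup>2) * s n\<bar>)"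
    using assms(1,4) by (rule summable_gauss_mult)
  have "(\<Sum>n. (-1)^n * q ^ (n * (n + 1)) * s n)
    = (\<Sum>n. exp a * ((-1)^n * exp (- a * (2 * real n + 1)\<^sup>2) * s n))"
    unfolding e by (simp add: mult_ac)
  also have "\<dots> = exp a * (\<Sum>n. (-1)^n * exp (- a * (2 * real n + 1)\<^sup>2) * s n)"
    by (rule suminf_mult[OF summable_rabs_cancel[OF sums]])
  finally have "exp a / p * (\<Sum>n. (-1)^n * exp (- a * (2 * real n + 1)\<^sup>2) * s n)
    = (\<Sum>n. (-1)^n * q ^ (n * (n + 1)) * s n) / p"
    by simp
  moreover have "summable (\<lambda>n. exp a * \<bar>(-1)^n * exp (- a * (2 * real n + 1)\<^sup>2) * s n\<bar>)"
    by (rule summable_mult[OF sums])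
  then have "summable (\<lambda>n. \<bar>q ^ (n * (n + 1)) * s n\<bar>)"
    unfolding e by (simp add: abs_mult mult_ac)
  ultimately show ?thesis
    using jtp_tannery[of q p s] p assms(1) by (simp add: q_def)
qed

section \<open>Positivity and logarithmic derivative from the product\<close>

definition jtp_prod :: "real \<Rightarrow> nat \<Rightarrow> real \<Rightarrow> real" where
  "jtp_prod q N \<phi> = sin \<phi> * (\<Prod>k<N. 1 - 2 * q ^ (2 * Suc k) * cos (2 * \<phi>) + (q ^ (2 * Suc k))\<^sup>2)"

text \<open>The logarithmic derivative in \<open>\<phi>\<close> of the factor containing
  \<open>q ^ (2 * k)\<close>. The product starts with \<open>q ^ 2\<close>, so it is used at
  \<open>Suc k\<close>.\<close>

definition jtp_logderiv :: "real \<Rightarrow> nat \<Rightarrow> real \<Rightarrow> real" where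
  "jtp_logderiv q k \<phi> = 4 * q ^ (2 * k) * sin (2 * \<phi>)
     / (1 - 2 * q ^ (2 * k) * cos (2 * \<phi>) + (q ^ (2 * k))\<^sup>2)"

text \<open>The minimum over \<open>x\<close> is reached at \<open>cos x = 1\<close>, where the
  factor is a perfect square.\<close>

lemma jtp_factor_ge:
  fixes q x :: real
  assumes "0 < q" "q < 1"
  shows "(1 - q ^ (2 * Suc k))\<^sup>2 \<le> 1 - 2 * q ^ (2 * Suc k) * cos x + (q ^ (2 * Suc k))\<^sup>2"
  using mult_left_mono[OF cos_le_one[of x], of "2 * q ^ (2 * Suc k)"] assms
  by (simp add: power2_diff)

lemma jtp_factor_pos:
  fixes q x :: real
  assumes "0 < q" "q < 1"
  shows "0 < 1 - 2 * q ^ (2 * Suc k) * cos x + (q ^ (2 * Suc k))\<^sup>2"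
  using jtp_factor_ge[OF assms, of k x] one_minus_power_pos[OF assms, of k]
  by (smt (verit) zero_less_power)

lemma has_real_derivative_jtp_prod:
  assumes q: "0 < q" "q < 1" and "sin \<phi> \<noteq> 0"
  shows "(jtp_prod q N has_real_derivative
    jtp_prod q N \<phi> * (cot \<phi> + (\<Sum>k<N. jtp_logderiv q (Suc k) \<phi>))) (at \<phi>)"
proof -
  let ?f = "\<lambda>k \<phi>. 1 - 2 * q ^ (2 * Suc k) * cos (2 * \<phi>) + (q ^ (2 * Suc k))\<^sup>2"
  have "((\<lambda>\<phi>. \<Prod>k<N. ?f k \<phi>) has_real_derivative
      (\<Prod>k<N. ?f k \<phi>) * (\<Sum>k<N. 4 * q ^ (2 * Suc k) * sin (2 * \<phi>) / ?f k \<phi>)) (at \<phi>)"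
  proof (rule has_field_derivative_prod')
    show "?f k \<phi> \<noteq> 0" for k
      using jtp_factor_pos[OF q, of k "2 * \<phi>"] by simp
    show "(?f k has_real_derivative 4 * q ^ (2 * Suc k) * sin (2 * \<phi>)) (at \<phi>)" for k
      by (auto intro!: derivative_eq_intros)
  qed
  from DERIV_mult[OF DERIV_sin this] show ?thesis
    unfolding jtp_prod_def [abs_def] jtp_logderiv_def
    by (rule DERIV_cong) (use assms(3) in \<open>simp add: cot_def field_simps\<close>)
qed

lemma jtp_prod_tendsto:
  assumes "a > 0" and p: "p > 0" "qpoch (exp (- 4 * a)) \<longlonglongrightarrow> p"
  shows "(\<lambda>N. jtp_prod (exp (- 4 * a)) N \<phi>) \<longlonglongrightarrow> exp a / p * jtheta a \<phi>"
proof -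
  have "jtp_prod (exp (- 4 * a)) N \<phi> = (\<Sum>n<Suc N. (-1)^n *
      (jtp_coeff (exp (- 4 * a)) N (int n) * exp (- 4 * a) ^ (n * (n + 1))) * sin ((2 * real n + 1) * \<phi>))" for N
    unfolding jtp_prod_def by (rule finite_jacobi_triple_product) (use assms(1) in auto)
  then show ?thesis
    unfolding jtheta_def using jtp_tannery_jtheta[OF assms odd_trig_bounds(1), of "\<lambda>n. (2 * real n + 1) * \<phi>"]
    by simp
qed

text \<open>The finite identity is differentiated before the limit is taken, and Tannery's theorem
  is then applied to the differentiated sum. Limit and derivative are thus never
  interchanged.\<close>

lemma jtp_prod_deriv_tendsto:
  assumes "a > 0" and p: "p > 0" "qpoch (exp (- 4 * a)) \<longlonglongrightarrow> p" and "sin \<phi> \<noteq> 0"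
  defines "q \<equiv> exp (- 4 * a)"
  shows "(\<lambda>N. jtp_prod q N \<phi> * (cot \<phi> + (\<Sum>k<N. jtp_logderiv q (Suc k) \<phi>)))
    \<longlonglongrightarrow> exp a / p * jtheta_deriv a \<phi>"
proof -
  have q: "0 < q" "q < 1"
    using assms(1) by (auto simp: q_def)
  have "jtp_prod q N \<phi> * (cot \<phi> + (\<Sum>k<N. jtp_logderiv q (Suc k) \<phi>)) = (\<Sum>n<Suc N. (-1)^n *
      (jtp_coeff q N (int n) * q ^ (n * (n + 1))) * ((2 * real n + 1) * cos ((2 * real n + 1) * \<phi>)))" for N
  proof (rule DERIV_unique[OF has_real_derivative_jtp_prod[OF q assms(4)]])
    show "(jtp_prod q N has_real_derivative (\<Sum>n<Suc N. (-1)^n * (jtp_coeff q N (int n) * q ^ (n * (n + 1)))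
        * ((2 * real n + 1) * cos ((2 * real n + 1) * \<phi>)))) (at \<phi>)"
      unfolding jtp_prod_def [abs_def] finite_jacobi_triple_product[OF q lessI]
      by (intro DERIV_sum DERIV_cmult) (auto intro!: derivative_eq_intros)
  qed
  then show ?thesis
    unfolding jtheta_deriv_def q_def
    using jtp_tannery_jtheta[OF assms(1-3) odd_trig_bounds(2), of "\<lambda>n. (2 * real n + 1) * \<phi>"]
    by simp
qed

text \<open>Positivity of the partial products alone would only give a nonnegative limit. Strictness
  comes from the lower bound \<open>sin \<phi> * p^2\<close>, which does not depend on
  \<open>N\<close>.\<close>

lemma jtheta_pos:
  assumes "a > 0" "0 < \<phi>" "\<phi> < pi"
  shows "jtheta a \<phi> > 0"
proof -
  define q where "q = exp (- 4 * a)"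
  have q: "0 < q" "q < 1"
    using assms(1) by (auto simp: q_def)
  obtain p where p: "p > 0" "qpoch q \<longlonglongrightarrow> p" "\<And>n. p \<le> qpoch q n"
    using qpoch_limit[OF q] by metis
  have s: "sin \<phi> > 0"
    using assms by (intro sin_gt_zero)
  have "sin \<phi> * p\<^sup>2 \<le> jtp_prod q N \<phi>" for N
  proof -
    have "p\<^sup>2 \<le> (qpoch q N)\<^sup>2"
      using p by (intro power_mono) auto
    also have "\<dots> = (\<Prod>k<N. (1 - q ^ (2 * Suc k))\<^sup>2)"
      by (simp only: qpoch_def prod_power_distrib)
    also have "\<dots> \<le> (\<Prod>k<N. 1 - 2 * q ^ (2 * Suc k) * cos (2 * \<phi>) + (q ^ (2 * Suc k))\<^sup>2)"
      by (intro prod_mono conjI jtp_factor_ge[OF q] zero_le_power2)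
    finally show ?thesis
      unfolding jtp_prod_def using s by (intro mult_left_mono) auto
  qed
  moreover have "(\<lambda>N. jtp_prod q N \<phi>) \<longlonglongrightarrow> exp a / p * jtheta a \<phi>"
    using jtp_prod_tendsto[OF assms(1), of p] p by (simp add: q_def)
  ultimately have "sin \<phi> * p\<^sup>2 \<le> exp a / p * jtheta a \<phi>"
    by (intro LIMSEQ_le_const) auto
  moreover have "sin \<phi> * p\<^sup>2 > 0"
    using s p by simp
  ultimately have "0 < exp a / p * jtheta a \<phi>"
    by linarith
  then show ?thesis
    using p(1) by (simp add: zero_less_mult_iff zero_less_divide_iff)
qed

text \<open>Dividing the limit of the derivatives by the limit of the products cancels the constant
  \<open>exp a / p\<close>.\<close>

lemma jtheta_logderiv_sums:
  assumes "a > 0" "0 < \<phi>" "\<phi> < pi"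
  shows "(\<lambda>k. jtp_logderiv (exp (- 4 * a)) (Suc k) \<phi>) sums
    (jtheta_deriv a \<phi> / jtheta a \<phi> - cot \<phi>)"
proof -
  define q where "q = exp (- 4 * a)"
  have q: "0 < q" "q < 1"
    using assms(1) by (auto simp: q_def)
  obtain p where p: "p > 0" "qpoch q \<longlonglongrightarrow> p"
    using qpoch_limit[OF q] by metis
  have s: "sin \<phi> > 0"
    using assms by (intro sin_gt_zero)
  have pos: "jtp_prod q N \<phi> > 0" for N
    unfolding jtp_prod_def by (intro mult_pos_pos s prod_pos jtp_factor_pos q)
  have "(\<lambda>N. jtp_prod q N \<phi> * (cot \<phi> + (\<Sum>k<N. jtp_logderiv q (Suc k) \<phi>)) / jtp_prod q N \<phi> - cot \<phi>)
      \<longlonglongrightarrow> (exp a / p * jtheta_deriv a \<phi>) / (exp a / p * jtheta a \<phi>) - cot \<phi>"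
    using jtheta_pos[OF assms] p(1) p(2)[unfolded q_def] s assms(1)
    unfolding q_def by (intro tendsto_intros jtp_prod_deriv_tendsto jtp_prod_tendsto) auto
  then show ?thesis
    using p(1) pos by (simp add: sums_def q_def less_imp_neq[THEN not_sym])
qed

section \<open>The Weierstrass zeta function as a sum of cotangents\<close>

text \<open>The reflection formula for \<open>rGamma\<close> is differentiated on both
  sides.\<close>

lemma Digamma_reflection:
  fixes z :: complex
  assumes "z \<notin> \<int>"
  shows "Digamma (1 - z) - Digamma z = of_real pi * cot (of_real pi * z)"
proof -
  have z: "z \<notin> \<int>\<^sub>\<le>\<^sub>0" "1 - z \<notin> \<int>\<^sub>\<le>\<^sub>0"
    using assms by (auto dest: nonpos_Ints_Int)
  have "sin (of_real pi * z) \<noteq> 0"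
    using assms by (auto simp: sin_eq_0)
  have "((\<lambda>z. rGamma z * rGamma (1 - z)) has_field_derivative
      rGamma z * rGamma (1 - z) * (Digamma (1 - z) - Digamma z)) (at z)"
    using z by (auto intro!: derivative_eq_intros simp: algebra_simps)
  moreover have "((\<lambda>z. rGamma z * rGamma (1 - z)) has_field_derivative cos (of_real pi * z)) (at z)"
    unfolding rGamma_reflection_complex by (auto intro!: derivative_eq_intros)
  ultimately have "sin (of_real pi * z) / of_real pi * (Digamma (1 - z) - Digamma z) = cos (of_real pi * z)"
    unfolding rGamma_reflection_complex by (rule DERIV_unique)
  then show ?thesis
    using \<open>sin (of_real pi * z) \<noteq> 0\<close> by (simp add: cot_def field_simps)
qed

lemma Digamma_diff_sums:
  fixes w z :: complex
  assumes "w \<noteq> 0" "z \<noteq> 0"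
  shows "(\<lambda>k. 1 / (w + of_nat k) - 1 / (z + of_nat k)) sums (Digamma z - Digamma w)"
  using sums_diff[OF summable_sums[OF summable_Digamma[OF assms(2)]]
      summable_sums[OF summable_Digamma[OF assms(1)]]]
  by (simp add: Digamma_def inverse_eq_divide algebra_simps)

lemma has_sum_int_split:
  fixes f :: "int \<Rightarrow> 'a :: topological_comm_monoid_add"
  assumes "((\<lambda>k. f (int k)) has_sum A) UNIV" "((\<lambda>k. f (- int (Suc k))) has_sum B) UNIV"
  shows "(f has_sum (A + B)) UNIV"
proof -
  have "inj (\<lambda>k. - int (Suc k))"
    by (auto intro: injI)
  then have "(f has_sum A) (range int)" "(f has_sum B) (range (\<lambda>k. - int (Suc k)))"
    using assms by (auto simp: has_sum_reindex o_def)
  moreover have "range int \<inter> range (\<lambda>k. - int (Suc k)) = {}"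
    by auto
  moreover have "range int \<union> range (\<lambda>k. - int (Suc k)) = UNIV"
    by (metis (no_types, lifting) UNIV_eq_I UnCI int_cases rangeI)
  ultimately show ?thesis
    using has_sum_Un_disjoint by metis
qed

text \<open>Once \<open>real k\<close> exceeds \<open>2 * norm w\<close> and
  \<open>2 * norm z\<close>, both denominators have norm at least \<open>real k / 2\<close>, so the
  difference is of order \<open>1 / k^2\<close>.\<close>

lemma summable_norm_reciprocal_diff:
  fixes w z :: complex
  shows "summable (\<lambda>k. norm (1 / (w + of_nat k) - 1 / (z + of_nat k)))"
proof (rule summable_comparison_test_ev)
  show "summable (\<lambda>k. 4 * norm (z - w) / real k ^ 2)"
    using summable_mult[OF inverse_power_summable[of 2, where 'a = real], of "4 * norm (z - w)"]
    by (simp add: field_simps)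
  have "norm (norm (1 / (w + of_nat k) - 1 / (z + of_nat k))) \<le> 4 * norm (z - w) / real k ^ 2"
    if k: "real k > 2 * norm w" "real k > 2 * norm z" for k
  proof -
    have k0: "real k > 0"
      using k norm_ge_zero[of w] by linarith
    have *: "real k / 2 \<le> norm (u + of_nat k)" if "real k > 2 * norm u" for u :: complex
      using norm_triangle_ineq2[of "of_nat k" "- u"] that by (simp add: add.commute)
    then have w: "real k / 2 \<le> norm (w + of_nat k)" and z: "real k / 2 \<le> norm (z + of_nat k)"
      using k by auto
    then have nz: "w + of_nat k \<noteq> 0" "z + of_nat k \<noteq> 0"
      using k0 by auto
    then have "1 / (w + of_nat k) - 1 / (z + of_nat k) = (z - w) / ((w + of_nat k) * (z + of_nat k))"
      by (simp add: divide_simps)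
    then have "norm (1 / (w + of_nat k) - 1 / (z + of_nat k))
        = norm (z - w) / (norm (w + of_nat k) * norm (z + of_nat k))"
      by (simp add: norm_divide norm_mult)
    also have "\<dots> \<le> norm (z - w) / (real k / 2 * (real k / 2))"
      using w z nz k0 by (intro divide_left_mono mult_mono) auto
    finally show ?thesis
      by (simp add: power2_eq_square mult.commute)
  qed
  moreover have "eventually (\<lambda>k. real k > 2 * norm w \<and> real k > 2 * norm z) sequentially"
    by (intro eventually_conj; real_asymp)
  ultimately show "eventually (\<lambda>k. norm (norm (1 / (w + of_nat k) - 1 / (z + of_nat k)))
      \<le> 4 * norm (z - w) / real k ^ 2) sequentially"
    by (auto elim!: eventually_mono)
qed

text \<open>A single family \<open>1 / (a - of_int m)\<close> is not absolutely summable, but the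
  paired one is. Each half of the integers gives a difference of Digamma values, and reflection
  combines the four values into cotangents.\<close>

lemma cot_partial_fractions:
  fixes a b :: complex
  assumes "a \<notin> \<int>" "b \<notin> \<int>"
  shows "((\<lambda>m::int. 1 / (a - of_int m) + 1 / (b + of_int m)) has_sum
    (of_real pi * cot (of_real pi * a) + of_real pi * cot (of_real pi * b))) UNIV"
proof -
  have shift: "- a \<noteq> 0" "b \<noteq> 0" "1 + a \<noteq> 0" "1 - b \<noteq> 0"
    using assms by (auto simp: add_eq_0_iff2 minus_equation_iff[of a 1])
  have "((\<lambda>k. 1 / (b + of_nat k) - 1 / (- a + of_nat k)) has_sum (Digamma (- a) - Digamma b)) UNIV"
    by (intro norm_summable_imp_has_sum summable_norm_reciprocal_diff Digamma_diff_sums shift)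
  moreover have "1 / (b + of_nat k) - 1 / (- a + of_nat k) = 1 / (a - of_int (int k)) + 1 / (b + of_int (int k))" for k
  proof -
    have "- a + of_nat k = - (a - of_int (int k))"
      by simp
    then show ?thesis
      by (simp only: minus_divide_right[symmetric]) simp
  qed
  ultimately have 1: "((\<lambda>k. 1 / (a - of_int (int k)) + 1 / (b + of_int (int k)))
      has_sum (Digamma (- a) - Digamma b)) UNIV"
    by (simp only:)
  have "((\<lambda>k. 1 / (1 + a + of_nat k) - 1 / (1 - b + of_nat k)) has_sum (Digamma (1 - b) - Digamma (1 + a))) UNIV"
    by (intro norm_summable_imp_has_sum summable_norm_reciprocal_diff Digamma_diff_sums shift)
  moreover have "1 / (1 + a + of_nat k) - 1 / (1 - b + of_nat k) =
      1 / (a - of_int (- int (Suc k))) + 1 / (b + of_int (- int (Suc k)))" for k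
  proof -
    have "b + of_int (- int (Suc k)) = - (1 - b + of_nat k)" "a - of_int (- int (Suc k)) = 1 + a + of_nat k"
      by simp_all
    then show ?thesis
      by (simp only: minus_divide_right[symmetric]) simp
  qed
  ultimately have 2: "((\<lambda>k. 1 / (a - of_int (- int (Suc k))) + 1 / (b + of_int (- int (Suc k))))
      has_sum (Digamma (1 - b) - Digamma (1 + a))) UNIV"
    by (simp only:)
  \<comment> \<open>Reflection is used at \<open>1 + a\<close>, since \<open>Digamma (- a)\<close>
    is \<open>Digamma (1 - (1 + a))\<close>; the period of the cotangent then removes the
    \<open>1\<close>.\<close>
  have "1 + a \<notin> \<int>"
    using assms(1) by (metis Ints_1 Ints_diff add_diff_cancel_left')
  then have "Digamma (- a) - Digamma b + (Digamma (1 - b) - Digamma (1 + a))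
      = of_real pi * cot (of_real pi * (1 + a)) + of_real pi * cot (of_real pi * b)"
    using Digamma_reflection[of "1 + a"] Digamma_reflection[OF assms(2)] by (simp add: algebra_simps)
  also have "cot (of_real pi * (1 + a)) = cot (of_real pi * a)"
    by (simp add: cot_def distrib_left sin_add cos_add flip: sin_of_real cos_of_real)
  finally show ?thesis
    using has_sum_int_split[OF 1 2] by simp
qed

section \<open>Absolute convergence of the lattice sum\<close>

lemma summable_on_int_powr:
  "(\<lambda>m::int. (1 + \<bar>real_of_int m\<bar>) powr (-3/2)) summable_on UNIV"
proof -
  have "summable (\<lambda>k. real (Suc k) powr (-3/2))"
    by (subst summable_Suc_iff) (simp add: summable_real_powr_iff)
  then have 1: "summable (\<lambda>k. (1 + \<bar>real_of_int (int k)\<bar>) powr (-3/2))"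
    by simp
  then have "summable (\<lambda>k. (1 + \<bar>real_of_int (int (Suc k))\<bar>) powr (-3/2))"
    by (subst summable_Suc_iff)
  then have 2: "summable (\<lambda>k. (1 + \<bar>real_of_int (- int (Suc k))\<bar>) powr (-3/2))"
    by simp
  from 1 2 have "(\<lambda>k. (1 + \<bar>real_of_int (int k)\<bar>) powr (-3/2)) summable_on UNIV"
    "(\<lambda>k. (1 + \<bar>real_of_int (- int (Suc k))\<bar>) powr (-3/2)) summable_on UNIV"
    by (intro norm_summable_imp_summable_on; simp)+
  then show ?thesis
    using has_sum_int_split unfolding summable_on_def by fast
qed

text \<open>The lower bound is a product in \<open>m\<close> and \<open>n\<close>. Its power
  \<open>-3/2\<close>, which bounds \<open>1 / norm \<Omega> ^ 3\<close> up to a constant, therefore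
  splits into two summable one-dimensional sequences.\<close>

lemma lattice_norm_bound:
  fixes s :: real and m n :: int
  assumes "s > 0" "(m, n) \<noteq> (0, 0)"
  shows "min 1 (s\<^sup>2) / 4 * ((1 + \<bar>real_of_int m\<bar>) * (1 + \<bar>real_of_int n\<bar>))
    \<le> (norm (of_int m + of_int n * (\<i> * of_real s)))\<^sup>2"
proof -
  define M where "M = max \<bar>real_of_int m\<bar> \<bar>real_of_int n\<bar>"
  have "\<bar>m\<bar> \<ge> 1 \<or> \<bar>n\<bar> \<ge> 1"
    using assms(2) by auto
  then have M1: "M \<ge> 1"
    unfolding M_def by linarith
  have "(1 + \<bar>real_of_int m\<bar>) * (1 + \<bar>real_of_int n\<bar>) \<le> (2 * M) * (2 * M)"
    using M1 unfolding M_def by (intro mult_mono) auto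
  then have "min 1 (s\<^sup>2) / 4 * ((1 + \<bar>real_of_int m\<bar>) * (1 + \<bar>real_of_int n\<bar>)) \<le> min 1 (s\<^sup>2) / 4 * ((2 * M) * (2 * M))"
    using assms(1) by (intro mult_left_mono) auto
  also have "\<dots> = min 1 (s\<^sup>2) * M\<^sup>2"
    by (simp add: power2_eq_square)
  also have "\<dots> \<le> (real_of_int m)\<^sup>2 + s\<^sup>2 * (real_of_int n)\<^sup>2"
  proof (cases "\<bar>real_of_int m\<bar> \<le> \<bar>real_of_int n\<bar>")
    case True
    then have "min 1 (s\<^sup>2) * M\<^sup>2 \<le> s\<^sup>2 * (real_of_int n)\<^sup>2"
      by (simp add: M_def mult_right_mono)
    then show ?thesis
      using zero_le_power2[of "real_of_int m"] by linarith
  next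
    case False
    then have "min 1 (s\<^sup>2) * M\<^sup>2 \<le> 1 * (real_of_int m)\<^sup>2"
      unfolding M_def by (intro mult_mono) auto
    then show ?thesis
      by (simp add: add_increasing2)
  qed
  also have "\<dots> = (norm (of_int m + of_int n * (\<i> * of_real s)))\<^sup>2"
    by (simp add: cmod_power2 power_mult_distrib)
  finally show ?thesis .
qed

definition zeta_term :: "complex \<Rightarrow> complex \<Rightarrow> complex" where
  "zeta_term z \<Omega> = 1 / (z - \<Omega>) + 1 / \<Omega> + z / \<Omega>\<^sup>2"

text \<open>The three fractions combine to \<open>x^2 / (\<Omega>^2 * (x - \<Omega>))\<close>, and
  \<open>norm (x - \<Omega>)\<close> is at least \<open>(1 - x) * norm \<Omega>\<close>, which gives
  cubic decay.\<close>

lemma norm_zeta_term_le: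
  fixes s x :: real and m n :: int
  assumes "s > 0" "0 < x" "x < 1" "(m, n) \<noteq> (0, 0)"
  shows "norm (zeta_term (of_real x) (of_int m + of_int n * (\<i> * of_real s)))
    \<le> x\<^sup>2 / (1 - x) * (min 1 (s\<^sup>2) / 4) powr (-3/2)
       * ((1 + \<bar>real_of_int m\<bar>) powr (-3/2) * (1 + \<bar>real_of_int n\<bar>) powr (-3/2))"
proof -
  define \<Omega> where "\<Omega> = of_int m + of_int n * (\<i> * of_real s)"
  define P where "P = min 1 (s\<^sup>2) / 4 * ((1 + \<bar>real_of_int m\<bar>) * (1 + \<bar>real_of_int n\<bar>))"
  have "P > 0"
    unfolding P_def using assms(1) by (intro mult_pos_pos) auto
  have P: "P \<le> (norm \<Omega>)\<^sup>2"
    unfolding P_def \<Omega>_def by (rule lattice_norm_bound) (use assms in auto)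
  then have nz: "norm \<Omega> > 0"
    using \<open>P > 0\<close> by (auto simp: zero_less_norm_iff)
  \<comment> \<open>The estimate for the norms is checked on real and imaginary parts separately;
    for \<open>m \<ge> 1\<close> it uses \<open>x \<le> x * m\<close>.\<close>
  have "(1 - x) * \<bar>real_of_int m\<bar> \<le> \<bar>x - real_of_int m\<bar>"
  proof (cases "m \<le> 0")
    case True
    then have "(1 - x) * \<bar>real_of_int m\<bar> \<le> 1 * \<bar>real_of_int m\<bar>"
      using assms by (intro mult_right_mono) auto
    then show ?thesis
      using True assms(2) by simp
  next
    case False
    then have "x * 1 \<le> x * real_of_int m"
      using assms by (intro mult_left_mono) auto
    then show ?thesis
      using False by (simp add: algebra_simps abs_if)
  qed
  then have "((1 - x) * \<bar>real_of_int m\<bar>)\<^sup>2 \<le> \<bar>x - real_of_int m\<bar>\<^sup>2"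
    using assms by (intro power_mono) auto
  moreover have "((1 - x) * \<bar>s * real_of_int n\<bar>)\<^sup>2 \<le> \<bar>s * real_of_int n\<bar>\<^sup>2"
    using assms by (intro power_mono) (auto simp: mult_left_le_one_le)
  ultimately have "((1 - x) * norm \<Omega>)\<^sup>2 \<le> (norm (of_real x - \<Omega>))\<^sup>2"
    unfolding \<Omega>_def by (simp add: cmod_power2 power_mult_distrib distrib_left mult_ac)
  then have le: "(1 - x) * norm \<Omega> \<le> norm (of_real x - \<Omega>)"
    by (rule power2_le_imp_le) simp
  have pos: "(1 - x) * norm \<Omega> > 0"
    using assms nz by simp
  then have pos': "norm (of_real x - \<Omega>) > 0"
    using le by linarith
  then have "of_real x - \<Omega> \<noteq> 0"
    by (simp only: zero_less_norm_iff not_False_eq_True)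
  then have "zeta_term (of_real x) \<Omega> = of_real x ^ 2 / (\<Omega>\<^sup>2 * (of_real x - \<Omega>))"
    unfolding zeta_term_def using nz by (simp add: divide_simps) (simp add: algebra_simps power2_eq_square)
  then have "norm (zeta_term (of_real x) \<Omega>) = x\<^sup>2 / ((norm \<Omega>)\<^sup>2 * norm (of_real x - \<Omega>))"
    using assms by (simp add: norm_divide norm_mult norm_power)
  also have "\<dots> \<le> x\<^sup>2 / ((norm \<Omega>)\<^sup>2 * ((1 - x) * norm \<Omega>))"
    using le pos pos' nz assms by (intro divide_left_mono mult_left_mono mult_pos_pos) auto
  also have "\<dots> = x\<^sup>2 / (1 - x) * (norm \<Omega>) powr (-3)"
    using nz by (simp add: powr_minus power2_eq_square power3_eq_cube field_simps)
  also have "(norm \<Omega>) powr (-3) = ((norm \<Omega>)\<^sup>2) powr (-3/2)"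
    using nz by (simp add: powr_powr flip: powr_numeral)
  also have "x\<^sup>2 / (1 - x) * \<dots> \<le> x\<^sup>2 / (1 - x) * P powr (-3/2)"
    using P \<open>P > 0\<close> assms by (intro mult_left_mono powr_mono2') auto
  also have "P powr (-3/2) = (min 1 (s\<^sup>2) / 4) powr (-3/2)
       * ((1 + \<bar>real_of_int m\<bar>) powr (-3/2) * (1 + \<bar>real_of_int n\<bar>) powr (-3/2))"
    unfolding P_def using assms(1) by (subst powr_mult; simp add: powr_mult)
  finally show ?thesis
    unfolding \<Omega>_def by (simp only: mult.assoc)
qed

lemma summable_on_zeta_term:
  fixes s x :: real
  assumes "s > 0" "0 < x" "x < 1"
  shows "(\<lambda>(m::int, n::int). zeta_term (of_real x) (of_int m + of_int n * (\<i> * of_real s)))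
    summable_on UNIV - {(0, 0)}"
proof -
  define h where "h = (\<lambda>m::int. (1 + \<bar>real_of_int m\<bar>) powr (-3/2))"
  define C where "C = x\<^sup>2 / (1 - x) * (min 1 (s\<^sup>2) / 4) powr (-3/2)"
  obtain S where S: "(h has_sum S) UNIV"
    using summable_on_int_powr unfolding h_def summable_on_def by blast
  have "(\<lambda>(m, n). C * (h m * h n)) summable_on UNIV \<times> UNIV"
  proof (rule summable_on_SigmaI)
    show "((\<lambda>n. case (m, n) of (m, n) \<Rightarrow> C * (h m * h n)) has_sum C * (h m * S)) UNIV" for m
      by (simp add: has_sum_cmult_right S)
    show "(\<lambda>m. C * (h m * S)) summable_on UNIV"
      by (intro summable_on_cmult_right summable_on_cmult_left has_sum_imp_summable[OF S])
  qed (use assms in \<open>auto simp: h_def C_def\<close>)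
  then have "(\<lambda>(m, n). C * (h m * h n)) summable_on UNIV - {(0, 0)}"
    by (rule summable_on_subset_banach) auto
  then show ?thesis
    by (rule abs_summable_summable[OF summable_on_comparison_test])
       (use norm_zeta_term_le[OF assms] in \<open>auto simp: h_def C_def\<close>)
qed

text \<open>Since \<open>1 / 0 = 0\<close>, the summand at the origin of the lattice is \<open>1 / z\<close>, so the zeta
  function is the sum over the whole lattice.\<close>

lemma has_sum_weierstrass_zeta:
  fixes s x :: real
  assumes "s > 0" "0 < x" "x < 1"
  shows "((\<lambda>(m::int, n::int). zeta_term (of_real x) (of_int m + of_int n * (\<i> * of_real s)))
    has_sum weierstrass_zeta (of_real x) 1 (\<i> * of_real s)) UNIV"
proof -
  have "((\<lambda>(m::int, n::int). zeta_term (of_real x) (of_int m + of_int n * (\<i> * of_real s)))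
    has_sum (1 / of_real x + infsum (\<lambda>(m::int, n::int). zeta_term (of_real x) (of_int m + of_int n * (\<i> * of_real s)))
      (UNIV - {(0, 0)}))) (insert (0, 0) (UNIV - {(0, 0)}))"
    using has_sum_insert[OF _ has_sum_infsum[OF summable_on_zeta_term[OF assms]], of "(0, 0)"]
    by (simp add: zeta_term_def)
  then show ?thesis
    by (simp add: weierstrass_zeta_def zeta_term_def Let_def insert_UNIV)
qed

text \<open>For \<open>n = 0\<close> the origin contributes nothing, because
  \<open>1 / 0 = 0\<close>. The value is never computed, as it is eliminated through the half
  period.\<close>

definition row_sum :: "real \<Rightarrow> int \<Rightarrow> complex" where
  "row_sum s n = (\<Sum>\<^sub>\<infinity>m::int. 1 / (of_int m + of_int n * (\<i> * of_real s))\<^sup>2)"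

text \<open>The sum over row \<open>n\<close> of the average of \<open>1 / (x - \<Omega>)\<close>
  and \<open>1 / (x + \<Omega>)\<close>.\<close>

definition cot_pair :: "real \<Rightarrow> real \<Rightarrow> int \<Rightarrow> complex" where
  "cot_pair s x n = of_real (pi / 2) * (cot (of_real pi * (of_real x - of_int n * (\<i> * of_real s)))
     + cot (of_real pi * (of_real x + of_int n * (\<i> * of_real s))))"

text \<open>Averaging the summands at \<open>\<Omega>\<close> and \<open>-\<Omega>\<close> cancels \<open>1 / \<Omega>\<close> and leaves, in each row of the
  lattice, two absolutely convergent sums: one is a sum of cotangents, the other is linear in \<open>x\<close>.\<close>

lemma has_sum_weierstrass_zeta_rows:
  fixes s x :: real
  assumes "s > 0" "0 < x" "x < 1"
  shows "((\<lambda>n. cot_pair s x n + of_real x * row_sum s n)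
    has_sum weierstrass_zeta (of_real x) 1 (\<i> * of_real s)) UNIV"
proof -
  define \<Omega> where "\<Omega> = (\<lambda>m n :: int. of_int m + of_int n * (\<i> * of_real s))"
  define Z where "Z = weierstrass_zeta (of_real x) 1 (\<i> * of_real s)"
  define F where "F = (\<lambda>n m. 1/2 * (1 / (of_real x - \<Omega> m n) + 1 / (of_real x + \<Omega> m n)) + of_real x * (1 / (\<Omega> m n)\<^sup>2))"
  have neg: "\<Omega> (- m) (- n) = - \<Omega> m n" for m n
    by (simp add: \<Omega>_def)
  have "((\<lambda>(m, n). zeta_term (of_real x) (\<Omega> m n)) has_sum Z) (UNIV \<times> UNIV)"
    using has_sum_weierstrass_zeta[OF assms] by (simp add: \<Omega>_def Z_def)
  then have 1: "((\<lambda>(n, m). zeta_term (of_real x) (\<Omega> m n)) has_sum Z) (UNIV \<times> UNIV)"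
    by (subst (asm) has_sum_swap) simp
  \<comment> \<open>Negation permutes the lattice, so the sum with \<open>- \<Omega>\<close> in
    place of \<open>\<Omega>\<close> has the same value.\<close>
  have "bij_betw (\<lambda>(n, m). (- n, - m)) (UNIV \<times> UNIV :: (int \<times> int) set) (UNIV \<times> UNIV)"
    by (rule bij_betwI[where g = "\<lambda>(n, m). (- n, - m)"]) auto
  from has_sum_reindex_bij_betw[OF this, of "\<lambda>(n, m). zeta_term (of_real x) (\<Omega> m n)" Z] 1
  have 2: "((\<lambda>(n, m). zeta_term (of_real x) (- \<Omega> m n)) has_sum Z) (UNIV \<times> UNIV)"
    by (simp add: case_prod_unfold neg)
  have "((\<lambda>p. 1/2 * ((case p of (n, m) \<Rightarrow> zeta_term (of_real x) (\<Omega> m n))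
       + (case p of (n, m) \<Rightarrow> zeta_term (of_real x) (- \<Omega> m n)))) has_sum (1/2 * (Z + Z))) (UNIV \<times> UNIV)"
    by (intro has_sum_cmult_right has_sum_add 1 2)
  also have "(\<lambda>p. 1/2 * ((case p of (n, m) \<Rightarrow> zeta_term (of_real x) (\<Omega> m n))
       + (case p of (n, m) \<Rightarrow> zeta_term (of_real x) (- \<Omega> m n)))) = (\<lambda>(n, m). F n m)"
  proof -
    have "1/2 * ((A + B + C) + (D - B + C)) = 1/2 * (A + D) + C" for A B C D :: complex
      by simp
    moreover have "zeta_term z (- w) = 1 / (z + w) - 1 / w + z / w\<^sup>2" for z w
      by (simp add: zeta_term_def)
    ultimately have "1/2 * (zeta_term z w + zeta_term z (- w))
        = 1/2 * (1 / (z - w) + 1 / (z + w)) + z * (1 / w\<^sup>2)" for z w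
      by (simp only: zeta_term_def[of z w] times_divide_eq_right mult_1_right)
    then show ?thesis
      by (simp only: case_prod_unfold F_def)
  qed
  finally have F: "((\<lambda>(n, m). F n m) has_sum Z) (UNIV \<times> UNIV)"
    by simp
  have "((\<lambda>m. F n m) has_sum (cot_pair s x n + of_real x * row_sum s n)) UNIV" for n
  proof -
    define b where "b = of_int n * (\<i> * of_real s)"
    have notint: "of_real x + of_int k * (\<i> * of_real s) \<notin> \<int>" for k
    proof
      assume "of_real x + of_int k * (\<i> * of_real s) \<in> (\<int> :: complex set)"
      then obtain j where "of_real x + of_int k * (\<i> * of_real s) = (of_int j :: complex)"
        by (auto elim: Ints_cases)
      then have "x = of_int j"
        by (auto simp: complex_eq_iff)
      then have "0 < j" "j < 1"
        using assms by simp_all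
      then show False
        by simp
    qed
    have "of_real x - b \<notin> \<int>" "of_real x + b \<notin> \<int>"
      using notint[of "- n"] notint[of n] by (simp_all add: b_def)
    from has_sum_cmult_right[OF cot_partial_fractions[OF this], of "1/2"]
    have c: "((\<lambda>m. 1/2 * (1 / (of_real x - \<Omega> m n) + 1 / (of_real x + \<Omega> m n))) has_sum cot_pair s x n) UNIV"
      by (simp add: \<Omega>_def cot_pair_def b_def algebra_simps)
    \<comment> \<open>Rows of a summable double family are summable; subtracting the cotangent part
      shows that \<open>1 / \<Omega>^2\<close> is summable along the row.\<close>
    have "(\<lambda>m. F n m) summable_on UNIV"
      using summable_on_SigmaD1[OF has_sum_imp_summable[OF F]] by simp
    from summable_on_add[OF this has_sum_imp_summable[OF has_sum_cmult_right[OF c, of "- 1"]]]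
    moreover have "A + B + - 1 * A = B" for A B :: complex
      by simp
    ultimately have "(\<lambda>m. of_real x * (1 / (\<Omega> m n)\<^sup>2)) summable_on UNIV"
      by (simp only: F_def)
    then have "(\<lambda>m. 1 / (\<Omega> m n)\<^sup>2) summable_on UNIV"
      using assms(2) by (subst (asm) summable_on_cmult_right') auto
    then have "((\<lambda>m. 1 / (\<Omega> m n)\<^sup>2) has_sum row_sum s n) UNIV"
      unfolding row_sum_def \<Omega>_def by (rule has_sum_infsum)
    from has_sum_add[OF c has_sum_cmult_right[OF this, of "of_real x"]] show ?thesis
      by (simp add: F_def)
  qed
  then show ?thesis
    using has_sum_SigmaD[OF F] unfolding Z_def by simp
qed

text \<open>At \<open>x = 1/2\<close> each pair is
  \<open>cot (pi / 2 - w) + cot (pi / 2 + w) = 0\<close> up to a factor, so the terms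
  \<open>1/2 * row_sum s n\<close> add up to \<open>weierstrass_eta1\<close>. Subtracting
  \<open>2 * x\<close> times this sum removes the linear part for every \<open>x\<close>.\<close>

lemma has_sum_zeta_minus_eta:
  fixes s x :: real
  assumes "s > 0" "0 < x" "x < 1"
  shows "(cot_pair s x has_sum (weierstrass_zeta (of_real x) 1 (\<i> * of_real s)
    - 2 * of_real x * weierstrass_eta1 1 (\<i> * of_real s))) UNIV"
proof -
  have "cot_pair s (1/2) n = 0" for n
  proof -
    have "of_real pi * (of_real (1/2) - w) = of_real pi / 2 - of_real pi * w"
      "of_real pi * (of_real (1/2) + w) = of_real pi / 2 + of_real pi * w" for w :: complex
      by (simp_all add: algebra_simps)
    then show ?thesis
      unfolding cot_pair_def cot_def
      by (simp only: sin_diff sin_add cos_diff cos_add) (simp add: sin_of_real cos_of_real)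
  qed
  with has_sum_weierstrass_zeta_rows[OF assms(1), of "1/2"]
  have "((\<lambda>n. 1/2 * row_sum s n) has_sum weierstrass_eta1 1 (\<i> * of_real s)) UNIV"
    by (simp add: weierstrass_eta1_def)
  from has_sum_add[OF has_sum_weierstrass_zeta_rows[OF assms] has_sum_cmult_right[OF this, of "- 2 * of_real x"]]
  show ?thesis
    by simp
qed

text \<open>Homogeneity of degree \<open>-1\<close>, used to normalise the first period to
  \<open>1\<close>.\<close>

lemma weierstrass_zeta_scale:
  assumes "c \<noteq> 0"
  shows "weierstrass_zeta (c * z) (c * p1) (c * p3) = weierstrass_zeta z p1 p3 / c"
proof -
  have *: "1 / (c * z - \<Omega>') + 1 / \<Omega>' + c * z / \<Omega>'\<^sup>2 = 1 / c * (1 / (z - \<Omega>) + 1 / \<Omega> + z / \<Omega>\<^sup>2)"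
    if "\<Omega>' = c * \<Omega>" for \<Omega> \<Omega>'
    unfolding that right_diff_distrib[symmetric] using assms
    by (simp add: power_mult_distrib add_divide_distrib field_simps power2_eq_square)
  have **: "of_int m * (c * p1) + of_int n * (c * p3) = c * (of_int m * p1 + of_int n * p3)" for m n
    by (simp add: algebra_simps)
  show ?thesis
    unfolding weierstrass_zeta_def Let_def case_prod_unfold * [OF **] infsum_cmult_right'
    by (simp add: add_divide_distrib)
qed

lemma weierstrass_eta1_scale:
  assumes "c \<noteq> 0"
  shows "weierstrass_eta1 (c * p1) (c * p3) = weierstrass_eta1 p1 p3 / c"
  using weierstrass_zeta_scale[OF assms, of "p1 / 2"] by (simp add: weierstrass_eta1_def)

section \<open>Comparison of the theta and zeta functions\<close>

lemma cot_add_cot: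
  fixes u v :: complex
  assumes "sin u \<noteq> 0" "sin v \<noteq> 0"
  shows "cot u + cot v = 2 * sin (u + v) / (cos (u - v) - cos (u + v))"
proof -
  have "cot u + cot v = sin (u + v) / (sin u * sin v)"
    using assms by (simp add: cot_def sin_add field_simps)
  also have "sin u * sin v = (cos (u - v) - cos (u + v)) / 2"
    by (simp add: cos_add cos_diff)
  finally show ?thesis
    by simp
qed

text \<open>The two arguments \<open>u\<close> and \<open>v\<close> are complex conjugates:
  \<open>u + v\<close> is real, and \<open>cos (u - v)\<close> is the hyperbolic cosine of
  \<open>2 * y\<close>, that is \<open>(E + 1 / E) / 2\<close> with
  \<open>E = q ^ (2 * Suc k)\<close> for the nome \<open>q\<close>.\<close>

lemma cot_pair_eq_jtp_logderiv:
  fixes s x :: real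
  assumes "s > 0"
  shows "cot_pair s x (int (Suc k)) = of_real (pi / 2 * jtp_logderiv (exp (- (pi * s))) (Suc k) (pi * x))"
proof -
  define y where "y = pi * real (Suc k) * s"
  define E where "E = exp (- (2 * y))"
  define \<phi> where "\<phi> = pi * x"
  have E: "exp (- (pi * s)) ^ (2 * Suc k) = E"
    unfolding E_def y_def by (simp only: exp_of_nat_mult[symmetric]) (simp add: algebra_simps)
  define u v :: complex where "u = of_real \<phi> - \<i> * of_real y" and "v = of_real \<phi> + \<i> * of_real y"
  have arg: "of_real pi * (of_real x - of_int (int (Suc k)) * (\<i> * of_real s)) = u"
    "of_real pi * (of_real x + of_int (int (Suc k)) * (\<i> * of_real s)) = v"
    by (simp_all add: u_def v_def \<phi>_def y_def algebra_simps)
  have "E > 0" "E < 1"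
    using assms unfolding E_def y_def by (auto intro!: mult_pos_pos)
  have "u + v = of_real (2 * \<phi>)" "u - v = - (\<i> * of_real (2 * y))"
    by (simp_all add: u_def v_def)
  moreover have "cos (- (\<i> * of_real (2 * y))) = (of_real ((E + 1 / E) / 2) :: complex)"
  proof -
    have "\<i> * (\<i> * of_real (2 * y)) = of_real (- (2 * y))"
      by (simp flip: mult.assoc)
    then have "cos (- (\<i> * of_real (2 * y))) = (exp (of_real (- (2 * y))) + exp (of_real (2 * y)) :: complex) / 2"
      by (simp add: cos_exp_eq)
    moreover have "exp (2 * y) = 1 / E"
      by (simp add: E_def exp_minus inverse_eq_divide)
    ultimately show ?thesis
      by (simp only: exp_of_real E_def[symmetric]) simp
  qed
  ultimately have uv: "sin (u + v) = of_real (sin (2 * \<phi>))" "cos (u + v) = of_real (cos (2 * \<phi>))"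
      "cos (u - v) = of_real ((E + 1 / E) / 2)"
    by (simp_all only: sin_of_real cos_of_real)
  have pos: "0 < 1 - 2 * E * cos (2 * \<phi>) + E\<^sup>2"
    using jtp_factor_pos[of "exp (- (pi * s))" k "2 * \<phi>"] assms unfolding E by simp
  have "2 * (sin u * sin v) = of_real ((E + 1 / E) / 2 - cos (2 * \<phi>))"
    unfolding of_real_diff uv(2,3)[symmetric] by (simp add: cos_add cos_diff)
  also have "(E + 1 / E) / 2 - cos (2 * \<phi>) = (1 - 2 * E * cos (2 * \<phi>) + E\<^sup>2) / (2 * E)"
    using \<open>E > 0\<close> by (simp add: field_simps power2_eq_square)
  finally have d: "2 * (sin u * sin v) = of_real ((1 - 2 * E * cos (2 * \<phi>) + E\<^sup>2) / (2 * E))" .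
  then have nz: "sin u \<noteq> 0" "sin v \<noteq> 0"
    using pos \<open>E > 0\<close> by (auto simp del: of_real_divide of_real_add of_real_diff)
  have "cot u + cot v = of_real (2 * sin (2 * \<phi>) / ((E + 1 / E) / 2 - cos (2 * \<phi>)))"
    unfolding cot_add_cot[OF nz] uv by simp
  also have "2 * sin (2 * \<phi>) / ((E + 1 / E) / 2 - cos (2 * \<phi>))
      = 4 * E * sin (2 * \<phi>) / (1 - 2 * E * cos (2 * \<phi>) + E\<^sup>2)"
    using \<open>E > 0\<close> pos by (simp add: field_simps power2_eq_square)
  finally show ?thesis
    unfolding cot_pair_def arg jtp_logderiv_def E by (simp add: \<phi>_def)
qed

lemma cot_pair_minus: "cot_pair s x (- n) = cot_pair s x n"
  by (simp add: cot_pair_def add.commute)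

text \<open>Row \<open>0\<close> contributes \<open>pi * cot (pi * x)\<close>. The rows of positive
  index and those of negative index contribute \<open>pi / 2 * (L - cot (pi * x))\<close> each, so
  the cotangent cancels in the total.\<close>

lemma weierstrass_zeta_eq_jtheta_logderiv:
  fixes s x :: real
  assumes "s > 0" "0 < x" "x < 1"
  shows "weierstrass_zeta (of_real x) 1 (\<i> * of_real s) - 2 * of_real x * weierstrass_eta1 1 (\<i> * of_real s)
    = of_real (pi * (jtheta_deriv (pi * s / 4) (pi * x) / jtheta (pi * s / 4) (pi * x)))"
proof -
  define L where "L = jtheta_deriv (pi * s / 4) (pi * x) / jtheta (pi * s / 4) (pi * x)"
  define T where "T = weierstrass_zeta (of_real x) 1 (\<i> * of_real s) - 2 * of_real x * weierstrass_eta1 1 (\<i> * of_real s)"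
  have T: "(cot_pair s x has_sum T) UNIV"
    unfolding T_def by (rule has_sum_zeta_minus_eta[OF assms])
  have "(\<lambda>k. jtp_logderiv (exp (- (pi * s))) (Suc k) (pi * x)) sums (L - cot (pi * x))"
    using jtheta_logderiv_sums[of "pi * s / 4" "pi * x"] assms by (simp add: L_def)
  then have sums: "(\<lambda>k. cot_pair s x (int (Suc k))) sums of_real (pi / 2 * (L - cot (pi * x)))"
    unfolding cot_pair_eq_jtp_logderiv[OF assms(1)] by (intro sums_of_real sums_mult)
  have summable: "(\<lambda>k. cot_pair s x (h k)) summable_on UNIV" if "inj h" for h :: "nat \<Rightarrow> int"
  proof -
    have "cot_pair s x summable_on range h"
      using has_sum_imp_summable[OF T] by (rule summable_on_subset_banach) simp
    then show ?thesis
      using that by (simp add: summable_on_reindex o_def)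
  qed
  have "(\<lambda>k. cot_pair s x (int k)) summable_on UNIV" "(\<lambda>k. cot_pair s x (- int (Suc k))) summable_on UNIV"
    by (rule summable; simp add: inj_def)+
  then obtain A B where A: "((\<lambda>k. cot_pair s x (int k)) has_sum A) UNIV"
    and B: "((\<lambda>k. cot_pair s x (- int (Suc k))) has_sum B) UNIV"
    unfolding summable_on_def by blast
  have "(\<lambda>k. cot_pair s x (int k)) sums (of_real (pi / 2 * (L - cot (pi * x))) + cot_pair s x (int 0))"
    using sums by (subst (asm) sums_Suc_iff) simp
  moreover have "cot_pair s x (int 0) = of_real (pi * cot (pi * x))"
    using cot_of_real[of "pi * x", where 'a = complex] by (simp add: cot_pair_def)
  ultimately have "A = of_real (pi / 2 * (L - cot (pi * x))) + of_real (pi * cot (pi * x))"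
    using has_sum_imp_sums[OF A] sums_unique2 by metis
  moreover have "B = of_real (pi / 2 * (L - cot (pi * x)))"
    using has_sum_imp_sums[OF B] sums sums_unique2 unfolding cot_pair_minus by metis
  moreover have "T = A + B"
    using has_sum_int_split[OF A B] T by (rule has_sum_unique[symmetric])
  ultimately have "T = of_real (pi / 2 * (L - cot (pi * x)) + pi * cot (pi * x) + pi / 2 * (L - cot (pi * x)))"
    by (simp only: of_real_add)
  also have "\<dots> = of_real (pi * L)"
    by (rule arg_cong[where f = of_real]) (simp add: field_simps)
  finally show ?thesis
    by (simp add: T_def L_def)
qed

text \<open>The summands with \<open>n = k + 1\<close> and \<open>n = - k\<close> have the same
  Gaussian factor and opposite signs and phases, so together they form a sine.\<close>

lemma theta1_eq_jtheta:
  fixes s v :: real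
  assumes "s > 0"
  shows "theta1 (of_real v) (\<i> * of_real s) = of_real (2 * jtheta (pi * s / 4) (pi * v))"
proof -
  define a where "a = pi * s / 4"
  have a: "a > 0"
    using assms by (simp add: a_def)
  define f where "f = (\<lambda>n::int. (-1) powi n * exp (of_real pi * \<i> * (\<i> * of_real s) * (of_int n - 1/2)^2)
     * exp ((2 * of_int n - 1) * of_real pi * \<i> * (of_real v :: complex)))"
  define G where "G = (\<lambda>k. of_real ((-1)^k * exp (- a * (2 * real k + 1)\<^sup>2)) :: complex)"
  define e where "e = (\<lambda>k. \<i> * of_real ((2 * real k + 1) * (pi * v)))"
  have f1: "f (int k + 1) = - (G k * exp (e k))" for k
  proof -
    have e1: "exp (of_real pi * \<i> * (\<i> * of_real s) * (of_int (int k + 1) - 1/2)^2)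
        = (of_real (exp (- a * (2 * real k + 1)\<^sup>2)) :: complex)"
      unfolding exp_of_real[symmetric]
      by (rule arg_cong[where f = exp]) (simp add: a_def field_simps power2_eq_square)
    have e2: "(2 * of_int (int k + 1) - 1) * of_real pi * \<i> * (of_real v :: complex) = e k"
      by (simp add: e_def algebra_simps)
    have e3: "(-1) powi (int k + 1) = (- ((-1)^k) :: complex)"
      by (simp add: power_int_add)
    show ?thesis
      unfolding f_def G_def e1 e2 e3 by simp
  qed
  have f2: "f (- int (Suc k) + 1) = G k * exp (- e k)" for k
  proof -
    have e1: "exp (of_real pi * \<i> * (\<i> * of_real s) * (of_int (- int (Suc k) + 1) - 1/2)^2)
        = (of_real (exp (- a * (2 * real k + 1)\<^sup>2)) :: complex)"
      unfolding exp_of_real[symmetric]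
      by (rule arg_cong[where f = exp]) (simp add: a_def field_simps power2_eq_square)
    have e2: "(2 * of_int (- int (Suc k) + 1) - 1) * of_real pi * \<i> * (of_real v :: complex) = - e k"
      by (simp add: e_def algebra_simps)
    have e3: "(-1) powi (- int (Suc k) + 1) = ((-1)^k :: complex)"
      by (simp add: power_int_minus flip: power_inverse)
    show ?thesis
      unfolding f_def G_def e1 e2 e3 by simp
  qed
  have G: "summable (\<lambda>k. norm (G k * c k))" if "\<And>k. norm (c k) = 1" for c
    using summable_gauss_mult[OF a, of "\<lambda>_. 1"] one_le_odd_square that
    by (simp add: G_def norm_mult norm_power abs_mult)
  have ne: "norm (exp (e k)) = 1" "norm (exp (- e k)) = 1" for k
    by (simp_all add: e_def)
  define A B where "A = (\<Sum>k. G k * exp (e k))" and "B = (\<Sum>k. G k * exp (- e k))"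
  have sA: "(\<lambda>k. G k * exp (e k)) sums A" and sB: "(\<lambda>k. G k * exp (- e k)) sums B"
    unfolding A_def B_def by (intro summable_sums summable_norm_cancel[OF G] ne)+
  have "((\<lambda>k. - (G k * exp (e k))) has_sum - A) UNIV"
    by (rule norm_summable_imp_has_sum) (use G[OF ne(1)] sums_minus[OF sA] in auto)
  moreover have "((\<lambda>k. G k * exp (- e k)) has_sum B) UNIV"
    by (rule norm_summable_imp_has_sum[OF G[OF ne(2)] sB])
  \<comment> \<open>Shifting the index by one makes these partners the values at
    \<open>int k\<close> and \<open>- int (Suc k)\<close>, as the splitting of the integers
    requires.\<close>
  ultimately have "((\<lambda>n. f (n + 1)) has_sum (- A + B)) UNIV"
    by (intro has_sum_int_split) (simp_all only: f1 f2)
  moreover have "bij_betw (\<lambda>n::int. n + 1) UNIV UNIV"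
    by (rule bij_betwI[where g = "\<lambda>n. n - 1"]) auto
  ultimately have "(f has_sum (- A + B)) UNIV"
    using has_sum_reindex_bij_betw[of "\<lambda>n. n + 1" UNIV UNIV f] by simp
  then have theta: "theta1 (of_real v) (\<i> * of_real s) = \<i> * (- A + B)"
    unfolding theta1_def f_def by (simp add: infsumI)
  have "(\<lambda>k. \<i> * (- (G k * exp (e k)) + G k * exp (- e k))) sums (\<i> * (- A + B))"
    by (intro sums_mult sums_add sums_minus sA sB)
  also have "(\<lambda>k. \<i> * (- (G k * exp (e k)) + G k * exp (- e k))) =
    (\<lambda>k. of_real (2 * ((-1)^k * exp (- a * (2 * real k + 1)\<^sup>2) * sin ((2 * real k + 1) * (pi * v)))))"
  proof
    fix k
    have "\<i> * (- (G k * exp (e k)) + G k * exp (- e k)) = G k * (\<i> * (exp (- e k) - exp (e k)))"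
      by (simp add: algebra_simps)
    also have "\<i> * (exp (- e k) - exp (e k)) = 2 * of_real (sin ((2 * real k + 1) * (pi * v)))"
      unfolding sin_of_real[symmetric] sin_exp_eq' by (simp add: e_def)
    finally show "\<i> * (- (G k * exp (e k)) + G k * exp (- e k)) =
      of_real (2 * ((-1)^k * exp (- a * (2 * real k + 1)\<^sup>2) * sin ((2 * real k + 1) * (pi * v))))"
      by (simp add: G_def)
  qed
  finally have "\<i> * (- A + B) = of_real (2 * jtheta a (pi * v))"
  proof (rule sums_unique2)
    show "(\<lambda>k. of_real (2 * ((-1)^k * exp (- a * (2 * real k + 1)\<^sup>2) * sin ((2 * real k + 1) * (pi * v)))))
    sums (of_real (2 * jtheta a (pi * v)) :: complex)"
      unfolding jtheta_def
      by (intro sums_of_real sums_mult summable_sums summable_rabs_cancel[OF summable_gauss_mult[OF a odd_trig_bounds(1)]])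
  qed
  then show ?thesis
    using theta by (simp only: a_def)
qed

section \<open>The logarithmic potential and the gauge transformation\<close>

locale elliptic_strip =
  fixes r tstar :: real
  assumes r: "r > 0"
begin

text \<open>This is \<open>pi * s / 4\<close> for \<open>tau r tstar t = \<i> * s\<close>.\<close>

definition a :: "real \<Rightarrow> real" where
  "a t = (tstar - t) / (8 * r\<^sup>2)"

definition j where "j t x = jtheta (a t) (x / (2 * r))"
definition j1 where "j1 t x = jtheta_deriv (a t) (x / (2 * r))"
definition j2 where "j2 t x = jtheta_deriv2 (a t) (x / (2 * r))"

text \<open>The values of the derivatives of \<open>- ln (2 * j t x)\<close>. The heat equation lets
  \<open>ut\<close> be written with the second derivative \<open>j2\<close>; its sign is positive
  since \<open>a\<close> decreases in time.\<close>

definition ux where "ux t x = - (j1 t x / j t x) / (2 * r)"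
definition uxx where "uxx t x = ((j1 t x / j t x)\<^sup>2 - j2 t x / j t x) / (4 * r\<^sup>2)"
definition ut where "ut t x = j2 t x / j t x / (8 * r\<^sup>2)"

lemma a_pos: "t < tstar \<Longrightarrow> a t > 0"
  using r by (simp add: a_def)

lemma j_pos: "t < tstar \<Longrightarrow> x \<in> {0<..<2 * pi * r} \<Longrightarrow> j t x > 0"
  unfolding j_def using r by (intro jtheta_pos a_pos) (auto simp: field_simps)

lemma tau_eq: "tau r tstar t = \<i> * of_real ((tstar - t) / (2 * pi * r\<^sup>2))"
  by (simp add: tau_def)

lemma U1_eq:
  assumes "t < tstar" "x \<in> {0<..<2 * pi * r}"
  shows "U1 r tstar t x = of_real (- ln (2 * j t x))"
proof -
  have "pi * ((tstar - t) / (2 * pi * r\<^sup>2)) / 4 = a t" "pi * (x / (2 * pi * r)) = x / (2 * r)"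
    by (simp_all add: a_def)
  moreover have "(tstar - t) / (2 * pi * r\<^sup>2) > 0"
    using assms r by simp
  ultimately have "theta1 (of_real (x / (2 * pi * r))) (tau r tstar t) = of_real (2 * j t x)"
    unfolding tau_eq using theta1_eq_jtheta by (simp only: j_def)
  then show ?thesis
    using j_pos[OF assms] unfolding U1_def by (simp add: Ln_of_real del: of_real_mult)
qed

lemma
  assumes "t < tstar"
  shows has_real_derivative_j: "(j t has_real_derivative j1 t x / (2 * r)) (at x)"
    and has_real_derivative_j1: "(j1 t has_real_derivative j2 t x / (2 * r)) (at x)"
    and has_real_derivative_j_time:
      "((\<lambda>t. j t x) has_real_derivative - j2 t x / (8 * r\<^sup>2)) (at t)"
proof -
  have x: "((\<lambda>x. x / (2 * r)) has_real_derivative 1 / (2 * r)) (at x)"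
    by (rule DERIV_cdivide[OF DERIV_ident])
  have t: "(a has_real_derivative - 1 / (8 * r\<^sup>2)) (at t)"
    unfolding a_def [abs_def] by (rule DERIV_cdivide) (auto intro!: derivative_eq_intros)
  show "(j t has_real_derivative j1 t x / (2 * r)) (at x)"
    using DERIV_chain2[OF has_real_derivative_jtheta[OF a_pos[OF assms]] x]
    by (simp add: j_def [abs_def] j1_def)
  show "(j1 t has_real_derivative j2 t x / (2 * r)) (at x)"
    using DERIV_chain2[OF has_real_derivative_jtheta_deriv[OF a_pos[OF assms]] x]
    by (simp add: j1_def [abs_def] j2_def)
  show "((\<lambda>t. j t x) has_real_derivative - j2 t x / (8 * r\<^sup>2)) (at t)"
    using DERIV_chain2[OF heat_equation_jtheta[OF a_pos[OF assms]] t]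
    by (simp add: j_def [abs_def] j2_def)
qed

lemma has_vector_derivative_U1:
  assumes "t < tstar" "x \<in> {0<..<2 * pi * r}"
  shows "(U1 r tstar t has_vector_derivative of_real (ux t x)) (at x)"
proof -
  have "((\<lambda>x. - ln (2 * j t x)) has_real_derivative ux t x) (at x)"
    using j_pos[OF assms] r
    by (auto intro!: derivative_eq_intros has_real_derivative_j[OF assms(1)] simp: ux_def field_simps)
  from has_vector_derivative_of_real[OF this] show ?thesis
    by (rule has_vector_derivative_transform_within_open[of _ _ _ "{0<..<2 * pi * r}"])
       (use assms in \<open>auto simp: U1_eq\<close>)
qed

lemma dx_U1:
  assumes "t < tstar" "x \<in> {0<..<2 * pi * r}"
  shows "dx (U1 r tstar) t x = of_real (ux t x)"
  unfolding dx_def by (rule vector_derivative_at[OF has_vector_derivative_U1[OF assms]])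

lemma has_vector_derivative_dx_U1:
  assumes "t < tstar" "x \<in> {0<..<2 * pi * r}"
  shows "(dx (U1 r tstar) t has_vector_derivative of_real (uxx t x)) (at x)"
proof -
  have "(ux t has_real_derivative uxx t x) (at x)"
    unfolding ux_def [abs_def] using j_pos[OF assms] r
    by (auto intro!: derivative_eq_intros has_real_derivative_j[OF assms(1)] has_real_derivative_j1[OF assms(1)]
        simp: uxx_def field_simps power2_eq_square)
  from has_vector_derivative_of_real[OF this] show ?thesis
    by (rule has_vector_derivative_transform_within_open[of _ _ _ "{0<..<2 * pi * r}"])
       (use assms in \<open>auto simp: dx_U1\<close>)
qed

text \<open>Makes the time derivative unique, also at \<open>t = 0\<close> where it is
  one-sided.\<close>

lemma at_within_Ico_neq_bot:
  assumes "t \<in> {0..<tstar}"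
  shows "at t within {0..<tstar} \<noteq> bot"
  using assms by (simp add: trivial_limit_within)

lemma has_vector_derivative_U1_time:
  assumes "t \<in> {0..<tstar}" "x \<in> {0<..<2 * pi * r}"
  shows "((\<lambda>t. U1 r tstar t x) has_vector_derivative of_real (ut t x)) (at t within {0..<tstar})"
proof -
  have t: "t < tstar"
    using assms by simp
  have "((\<lambda>t. - ln (2 * j t x)) has_real_derivative ut t x) (at t)"
    using j_pos[OF t assms(2)] r
    by (auto intro!: derivative_eq_intros has_real_derivative_j_time[OF t] simp: ut_def field_simps)
  from has_vector_derivative_at_within[OF has_vector_derivative_of_real[OF this]] show ?thesis
    by (rule has_vector_derivative_transform[rotated 2]) (use assms in \<open>auto simp: U1_eq\<close>)
qed

text \<open>The Cole-Hopf effect: \<open>j2 / j\<close> enters \<open>uxx\<close> with the factor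
  \<open>- 1 / (4 * r^2)\<close> and \<open>2 * ut\<close> with the opposite one, so only the square
  of \<open>j1 / j\<close> survives.\<close>

lemma burgers_equation:
  assumes "t < tstar" "x \<in> {0<..<2 * pi * r}"
  shows "(ux t x)\<^sup>2 = uxx t x + 2 * ut t x"
  using j_pos[OF assms] r by (simp add: ux_def uxx_def ut_def power2_eq_square field_simps)

text \<open>Scaling by \<open>c = 2 * pi * r\<close> reduces the periods to \<open>1\<close> and
  \<open>\<i> * s\<close>. The minus sign comes from \<open>U1\<close> being minus the
  logarithm.\<close>

lemma weierstrass_zeta_eq_ux:
  assumes "t < tstar" "x \<in> {0<..<2 * pi * r}"
  shows "weierstrass_zeta (of_real x) (of_real (2 * pi * r)) (period3 r tstar t)
    - of_real (x / (pi * r)) * weierstrass_eta1 (of_real (2 * pi * r)) (period3 r tstar t) = - of_real (ux t x)"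
proof -
  define s where "s = (tstar - t) / (2 * pi * r\<^sup>2)"
  define c where "c = 2 * pi * r"
  define v where "v = x / c"
  have c: "c > 0"
    using r by (simp add: c_def)
  have s: "s > 0"
    using assms r by (simp add: s_def)
  have v: "0 < v" "v < 1"
    using assms c by (auto simp: v_def c_def)
  have p: "period3 r tstar t = of_real c * (\<i> * of_real s)" "of_real c = (of_real c * 1 :: complex)"
    "of_real x = (of_real c * of_real v :: complex)" 
    using c r by (simp_all add: period3_def s_def c_def v_def power2_eq_square)
  have "x / (pi * r) = 2 * v"
    using r by (simp add: v_def c_def)
  have "weierstrass_zeta (of_real x) (of_real c) (period3 r tstar t)
    - of_real (x / (pi * r)) * weierstrass_eta1 (of_real c) (period3 r tstar t)
    = (weierstrass_zeta (of_real v) 1 (\<i> * of_real s) - 2 * of_real v * weierstrass_eta1 1 (\<i> * of_real s)) / of_real c"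
  proof -
    have "weierstrass_zeta (of_real x) (of_real c) (period3 r tstar t) = weierstrass_zeta (of_real v) 1 (\<i> * of_real s) / of_real c"
      using weierstrass_zeta_scale[of "of_real c" "of_real v" 1 "\<i> * of_real s"] c p by simp
    moreover have "weierstrass_eta1 (of_real c) (period3 r tstar t) = weierstrass_eta1 1 (\<i> * of_real s) / of_real c"
      using weierstrass_eta1_scale[of "of_real c" 1 "\<i> * of_real s"] c p by simp
    ultimately show ?thesis
      unfolding \<open>x / (pi * r) = 2 * v\<close> by (simp add: diff_divide_distrib)
  qed
  also have "\<dots> = of_real (pi * (jtheta_deriv (pi * s / 4) (pi * v) / jtheta (pi * s / 4) (pi * v)) / c)"
    unfolding weierstrass_zeta_eq_jtheta_logderiv[OF s v] by simp
  also have "pi * s / 4 = a t"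
    by (simp add: s_def a_def)
  also have "pi * v = x / (2 * r)"
    by (simp add: v_def c_def)
  also have "pi * (jtheta_deriv (a t) (x / (2 * r)) / jtheta (a t) (x / (2 * r))) / c = - ux t x"
    by (simp add: ux_def j_def j1_def c_def)
  finally show ?thesis
    by (simp add: c_def)
qed

end

section \<open>Gauge transformation by a general potential\<close>

text \<open>Derivatives within a set cover both the space derivative and the one-sided time
  derivative.\<close>

lemma has_vector_derivative_exp_gauge:
  fixes u f :: "real \<Rightarrow> complex"
  assumes "(u has_vector_derivative u') (at x within S)" "(f has_vector_derivative f') (at x within S)"
  shows "((\<lambda>x. exp (- (k * u x / 2)) * f x) has_vector_derivative
    exp (- (k * u x / 2)) * (f' - k / 2 * u' * f x)) (at x within S)"
proof -
  have "((\<lambda>x. - (k / 2) * u x) has_vector_derivative - (k / 2) * u') (at x within S)"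
    by (intro has_vector_derivative_mult_right assms)
  from field_vector_diff_chain_within[OF this has_field_derivative_at_within[OF DERIV_exp]]
  have "((\<lambda>x. exp (- (k * u x / 2))) has_vector_derivative - (k / 2) * u' * exp (- (k * u x / 2))) (at x within S)"
    by (simp add: o_def)
  from has_vector_derivative_mult[OF this assms(2)] show ?thesis
    by (simp add: algebra_simps)
qed

text \<open>The first-order terms in \<open>f\<close> cancel, leaving the potential
  \<open>k^2 / 8 * U'^2 - k / 4 * (U'' + 2 * ut)\<close>. The hypothesis \<open>burgers\<close>
  collapses it to \<open>k * (k - 2) / 8 * U'^2\<close>, which for \<open>k = D - 1\<close> has the
  factor \<open>(D - 1) * (D - 3) / 8\<close>.\<close>

lemma gauge_transform:
  fixes U f :: fld and k :: complex
  assumes S: "open S" "x \<in> S"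
    and U: "\<And>y. y \<in> S \<Longrightarrow> (U t has_vector_derivative dx U t y) (at y)"
      "(dx U t has_vector_derivative uxx) (at x)"
      "((\<lambda>s. U s x) has_vector_derivative ut) (at t within {0..<tstar})"
    and f: "\<And>y. y \<in> S \<Longrightarrow> (f t has_vector_derivative dx f t y) (at y)"
      "(dx f t has_vector_derivative dx (dx f) t x) (at x)"
      "((\<lambda>s. f s x) has_vector_derivative dt tstar f t x) (at t within {0..<tstar})"
    and nontriv: "at t within {0..<tstar} \<noteq> bot"
    and burgers: "(dx U t x)\<^sup>2 = uxx + 2 * ut"
  defines "g \<equiv> mult_op (\<lambda>t x. exp (- (k * U t x / 2))) f"
  shows "exp (k * U t x / 2) * (dt tstar g t x - (1/2 * dx (dx g) t x + k / 2 * dx (mult_op (dx U) g) t x))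
    = dt tstar f t x + (- 1/2 * dx (dx f) t x + k * (k - 2) / 8 * (dx U t x)\<^sup>2 * f t x)"
proof -
  define E where "E = exp (- (k * U t x / 2))"
  have g_eq: "g = (\<lambda>t x. exp (- (k * U t x / 2)) * f t x)"
    by (simp add: g_def mult_op_def)
  have gx: "(g t has_vector_derivative exp (- (k * U t y / 2)) * (dx f t y - k / 2 * dx U t y * f t y)) (at y)"
    if "y \<in> S" for y
    unfolding g_eq using U(1)[OF that] f(1)[OF that] by (rule has_vector_derivative_exp_gauge)
  \<comment> \<open>The formula is needed on the whole open set \<open>S\<close>, because
    \<open>dx g\<close> is differentiated once more at \<open>x\<close>.\<close>
  then have dx_g: "dx g t y = exp (- (k * U t y / 2)) * (dx f t y - k / 2 * dx U t y * f t y)" if "y \<in> S" for y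
    using that unfolding dx_def[of g] by (intro vector_derivative_at)
  have "((\<lambda>y. dx f t y - k / 2 * dx U t y * f t y) has_vector_derivative
      dx (dx f) t x - (k / 2 * dx U t x * dx f t x + k / 2 * uxx * f t x)) (at x)"
    by (intro has_vector_derivative_diff has_vector_derivative_mult has_vector_derivative_mult_right U f S)
  from has_vector_derivative_exp_gauge[OF U(1)[OF S(2)] this]
  have "(dx g t has_vector_derivative
      E * (dx (dx f) t x - (k / 2 * dx U t x * dx f t x + k / 2 * uxx * f t x)
           - k / 2 * dx U t x * (dx f t x - k / 2 * dx U t x * f t x))) (at x)"
    unfolding E_def
    by (rule has_vector_derivative_transform_within_open[OF _ S]) (simp add: dx_g)
  then have dxx_g: "dx (dx g) t x =
      E * (dx (dx f) t x - (k / 2 * dx U t x * dx f t x + k / 2 * uxx * f t x)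
           - k / 2 * dx U t x * (dx f t x - k / 2 * dx U t x * f t x))"
    unfolding dx_def[of "dx g"] by (rule vector_derivative_at)
  have "(mult_op (dx U) g t has_vector_derivative (dx U t x * (E * (dx f t x - k / 2 * dx U t x * f t x)) + uxx * g t x)) (at x)"
    unfolding mult_op_def E_def by (rule has_vector_derivative_mult[OF U(2) gx[OF S(2)]])
  then have "dx (mult_op (dx U) g) t x = dx U t x * (E * (dx f t x - k / 2 * dx U t x * f t x)) + uxx * g t x"
    unfolding dx_def[of "mult_op (dx U) g"] by (rule vector_derivative_at)
  then have dUg: "dx (mult_op (dx U) g) t x = E * (dx U t x * (dx f t x - k / 2 * dx U t x * f t x) + uxx * f t x)"
    by (simp add: g_eq E_def algebra_simps)
  have "((\<lambda>s. g s x) has_vector_derivative E * (dt tstar f t x - k / 2 * ut * f t x)) (at t within {0..<tstar})"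
    unfolding g_eq E_def using U(3) f(3) by (rule has_vector_derivative_exp_gauge)
  then have dt_g: "dt tstar g t x = E * (dt tstar f t x - k / 2 * ut * f t x)"
    unfolding dt_def[of _ g] by (rule vector_derivative_within[OF nontriv])
  have "exp (k * U t x / 2) * E = 1"
    by (simp add: E_def flip: exp_add)
  moreover have "dt tstar g t x - (1/2 * dx (dx g) t x + k / 2 * dx (mult_op (dx U) g) t x)
    = E * (dt tstar f t x + (- 1/2 * dx (dx f) t x + (k\<^sup>2 / 8 * (dx U t x)\<^sup>2 - k / 4 * (uxx + 2 * ut)) * f t x))"
    unfolding dxx_g dUg dt_g by (simp add: field_simps power2_eq_square)
  ultimately have "exp (k * U t x / 2) * (dt tstar g t x - (1/2 * dx (dx g) t x + k / 2 * dx (mult_op (dx U) g) t x))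
    = dt tstar f t x + (- 1/2 * dx (dx f) t x + (k\<^sup>2 / 8 * (dx U t x)\<^sup>2 - k / 4 * (uxx + 2 * ut)) * f t x)"
    by (simp flip: mult.assoc)
  also have "k\<^sup>2 / 8 * (dx U t x)\<^sup>2 - k / 4 * (uxx + 2 * ut) = k * (k - 2) / 8 * (dx U t x)\<^sup>2"
    unfolding burgers[symmetric] by (simp add: field_simps power2_eq_square)
  finally show ?thesis .
qed

theorem lemma2p1:
  fixes r tstar D :: real
  assumes "r > 0" and "tstar > 0" and "D > 1"
  shows
    "(\<forall>f. smooth_on_strip r tstar f \<longrightarrow>
        (\<forall>t\<in>{0..<tstar}. \<forall>x\<in>{0<..<2 * pi * r}.
          (mult_op (\<lambda>t x. exp (of_real (D - 1) * U1 r tstar t x / 2))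
             \<circ> (dt tstar - L1 D r tstar)
             \<circ> mult_op (\<lambda>t x. exp (- (of_real (D - 1) * U1 r tstar t x / 2)))) f t x
          = (dt tstar + H1 D r tstar) f t x))
     \<and> (\<forall>t\<in>{0..<tstar}. \<forall>x\<in>{0<..<2 * pi * r}.
          V1 D r tstar t x = of_real ((D - 1) * (D - 3) / 8) * (dx (U1 r tstar) t x)^2 \<and>
          V1 D r tstar t x = of_real ((D - 1) * (D - 3) / 8)
            * (dx (dx (U1 r tstar)) t x + 2 * dt tstar (U1 r tstar) t x) \<and>
          V1 D r tstar t x = of_real ((D - 1) * (D - 3) / 8)
            * (weierstrass_zeta (of_real x) (of_real (2 * pi * r)) (period3 r tstar t)
               - of_real (x / (pi * r))
                 * weierstrass_eta1 (of_real (2 * pi * r)) (period3 r tstar t))^2)"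
proof (intro conjI allI impI ballI)
  interpret elliptic_strip r tstar
    by standard fact
  fix t x assume tx: "t \<in> {0..<tstar}" "x \<in> {0<..<2 * pi * r}"
  then have t: "t < tstar"
    by simp
  note dU = dx_U1[OF t tx(2)]
  have dxx: "dx (dx (U1 r tstar)) t x = of_real (uxx t x)"
    unfolding dx_def[of "dx _"] by (rule vector_derivative_at[OF has_vector_derivative_dx_U1[OF t tx(2)]])
  have dtU: "dt tstar (U1 r tstar) t x = of_real (ut t x)"
    unfolding dt_def by (rule vector_derivative_within[OF at_within_Ico_neq_bot[OF tx(1)]
          has_vector_derivative_U1_time[OF tx]])
  have burgers: "(dx (U1 r tstar) t x)\<^sup>2 = of_real (uxx t x) + 2 * of_real (ut t x)"
    unfolding dU of_real_power[symmetric] burgers_equation[OF t tx(2)] by simp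
  show "V1 D r tstar t x = of_real ((D - 1) * (D - 3) / 8) * (dx (U1 r tstar) t x)^2"
    by (simp only: V1_def)
  show "V1 D r tstar t x = of_real ((D - 1) * (D - 3) / 8)
      * (dx (dx (U1 r tstar)) t x + 2 * dt tstar (U1 r tstar) t x)"
    by (simp only: V1_def dxx dtU burgers)
  show "V1 D r tstar t x = of_real ((D - 1) * (D - 3) / 8)
      * (weierstrass_zeta (of_real x) (of_real (2 * pi * r)) (period3 r tstar t)
         - of_real (x / (pi * r)) * weierstrass_eta1 (of_real (2 * pi * r)) (period3 r tstar t))^2"
    unfolding weierstrass_zeta_eq_ux[OF t tx(2)] by (simp only: V1_def dU power2_minus)
  fix f assume "smooth_on_strip r tstar f"
  \<comment> \<open>Two orders of smoothness supply the first derivatives in both variables and the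
    second one in space.\<close>
  then have "Ck_on_strip r tstar 2 f"
    by (simp add: smooth_on_strip_def)
  then have f: "(\<lambda>s. f s y) differentiable (at s within {0..<tstar})" "f s differentiable (at y)"
      "dx f s differentiable (at y)" if "s \<in> {0..<tstar}" "y \<in> {0<..<2 * pi * r}" for s y
    using that by (auto simp: numeral_2_eq_2)
  have "exp (of_real (D - 1) * U1 r tstar t x / 2) *
      (dt tstar (mult_op (\<lambda>t x. exp (- (of_real (D - 1) * U1 r tstar t x / 2))) f) t x
       - (1/2 * dx (dx (mult_op (\<lambda>t x. exp (- (of_real (D - 1) * U1 r tstar t x / 2))) f)) t x
          + of_real (D - 1) / 2 * dx (mult_op (dx (U1 r tstar)) (mult_op (\<lambda>t x. exp (- (of_real (D - 1) * U1 r tstar t x / 2))) f)) t x))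
    = dt tstar f t x + (- 1/2 * dx (dx f) t x
       + of_real (D - 1) * (of_real (D - 1) - 2) / 8 * (dx (U1 r tstar) t x)\<^sup>2 * f t x)"
  proof (rule gauge_transform[where S = "{0<..<2 * pi * r}" and uxx = "of_real (uxx t x)" and ut = "of_real (ut t x)"])
    show "(U1 r tstar t has_vector_derivative dx (U1 r tstar) t y) (at y)" if "y \<in> {0<..<2 * pi * r}" for y
      unfolding dx_U1[OF t that] by (rule has_vector_derivative_U1[OF t that])
    show "(f t has_vector_derivative dx f t y) (at y)" if "y \<in> {0<..<2 * pi * r}" for y
      using f(2)[OF tx(1) that] by (simp add: dx_def[of f] vector_derivative_works)
    show "(dx f t has_vector_derivative dx (dx f) t x) (at x)"
      using f(3)[OF tx] by (simp add: dx_def[of "dx f"] vector_derivative_works)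
    show "((\<lambda>s. f s x) has_vector_derivative dt tstar f t x) (at t within {0..<tstar})"
      using f(1)[OF tx] by (simp add: dt_def vector_derivative_works)
  qed (fact tx has_vector_derivative_dx_U1[OF t tx(2)] has_vector_derivative_U1_time[OF tx]
        at_within_Ico_neq_bot[OF tx(1)] burgers open_greaterThanLessThan)+
  moreover have "of_real (D - 1) * (of_real (D - 1) - 2) / 8 = (of_real ((D - 1) * (D - 3) / 8) :: complex)"
    by (simp add: algebra_simps)
  ultimately show "(mult_op (\<lambda>t x. exp (of_real (D - 1) * U1 r tstar t x / 2))
       \<circ> (dt tstar - L1 D r tstar)
       \<circ> mult_op (\<lambda>t x. exp (- (of_real (D - 1) * U1 r tstar t x / 2)))) f t x
     = (dt tstar + H1 D r tstar) f t x"
    unfolding o_apply fun_diff_def plus_fun_def L1_def H1_def V1_def by (subst mult_op_def) simp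
qed

end
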